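(* Let $\mathscr{T}$ be a nonstandard triangle in ${}^*\mathbb{R}P^2$ with vertices $p,q,x$, labelled and positioned as in the context, and let $\alpha=\frac{\varepsilon\delta}{\eta}$. Then $sh(\mathscr{G}(p,q,x))\le SL_3(\mathbb{R})$ is conjugate to a group in $\mathcal{Q}=\{C,F,N_1,N_2,N_3\}$, determined by the following table (a triangle satisfying the conditions in a row has $sh(\mathscr{G}(p,q,x))$ conjugate to the group at the end of the row; $\ast$ means no condition): $$\begin{array}{|c|c|c||c|} \hline \#\text{ infinitesimal angles} & \#\text{ infinitesimal sides} & \alpha & \text{group}\\ \hline 0&0&\text{appreciable}&C\\ 1&1&\text{finite}&F\\ 2&3&\text{appreciable}&N_1\\ \ast&3&\text{infinitesimal}&N_2\\ 2&\ast&\text{infinite}&N_3\\ \hline \end{array}$$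
   Context: The elements of $\mathcal{Q}$ are the following subgroups of $SL_3(\mathbb{R})$, where $a,b$ range over the positive reals and $s,t$ over $\mathbb{R}$: $$C=\left\{\begin{pmatrix}a&0&0\\0&b&0\\0&0&\frac1{ab}\end{pmatrix}\right\},\quad F=\left\{\begin{pmatrix}a&t&0\\0&a&0\\0&0&\frac1{a^2}\end{pmatrix}\right\},\quad N_1=\left\{\begin{pmatrix}1&s&t\\0&1&s\\0&0&1\end{pmatrix}\right\},$$ $$N_2=\left\{\begin{pmatrix}1&s&t\\0&1&0\\0&0&1\end{pmatrix}\right\},\quad N_3=\left\{\begin{pmatrix}1&0&t\\0&1&s\\0&0&1\end{pmatrix}\right\}.$$ ${}^*\mathbb{R}$ is the field of hyperreals, the ultrapower of $\mathbb{R}$ over $\mathbb{N}$ by a fixed nonprincipal ultrafilter. A hyperreal $\beta$ is infinite if $|\beta|>n$ for all $n\in\mathbb{N}$, finite if not infinite, infinitesimal if $|\beta|<\frac1n$ for all $n\ge 1$ (so $0$ is infinitesimal), and appreciable if it is neither infinite nor infinitesimal. A nonstandard triangle consists of three points $p,q,x\in{}^*\mathbb{R}P^2$ in general position and the three lines between them. $\mathscr{G}(p,q,x)\le SL_3({}^*\mathbb{R})$ is the conjugate of the group of diagonal matrices with positive (hyperreal) entries that fixes $p,q$ and $x$. The shadow of a subgroup $\mathscr{G}\le SL_3({}^*\mathbb{R})$ is the subgroup $sh(\mathscr{G})\le SL_3(\mathbb{R})$ of all real matrices whose entries differ by infinitesimals from the corresponding entries of some matrix in $\mathscr{G}$. Metric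 and labelling: ${}^*\mathbb{R}P^2$ carries the (nonstandard extension of the) constant positive curvature metric $d$ inherited from the unit sphere; the sides (shortest geodesic segments joining the vertices) and the interior angles of the triangle are measured in this metric. The vertices are labelled so that the shortest altitude of the triangle is the one measured from $x$ to the line $\mathscr{H}$ through $p$ and $q$; $y\in\mathscr{H}$ is the foot of this altitude, and $d(y,p)\le d(y,q)$. After an isometry of ${}^*\mathbb{R}P^2$ one has $p=[1:0:0]$, $q=[1:\delta:0]$, $y=[1:\varepsilon:0]$, $x=[1:\varepsilon:\eta]$ with $\delta,\varepsilon,\eta\in{}^*\mathbb{R}$, $\delta,\eta\ne0$, $|\eta|\le|\delta|$ and $|\varepsilon|\le|\delta|$ (the triangle is assumed to be in this normal form). *)

theory Defs
  imports "HOL-Analysis.Analysis"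
begin

section \<open>A nonprincipal ultrafilter on the natural numbers\<close>

text \<open>Nonprincipality is expressed by refining the cofinite filter.\<close>

definition nonprincipal_ultrafilter :: "nat filter \<Rightarrow> bool" where
  "nonprincipal_ultrafilter F \<longleftrightarrow>
     F \<noteq> bot \<and> F \<le> cofinite \<and> (\<forall>P. eventually P F \<or> eventually (\<lambda>n. \<not> P n) F)"

lemma nonprincipal_ultrafilter_exists: "\<exists>F. nonprincipal_ultrafilter F"
proof -
  define A :: "nat filter set" where "A = {F. F \<noteq> bot \<and> F \<le> cofinite}"
  have "\<exists>m\<in>A. \<forall>a\<in>A. m \<ge> a \<longrightarrow> a = m"
  proof (rule predicate_Zorn)
    show "partial_order_on A (relation_of (\<ge>) A)"
      by (rule partial_order_on_relation_ofI) auto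
  next
    fix C assume C: "C \<in> Chains (relation_of (\<ge>) A)"
    have CA: "F \<in> A" if "F \<in> C" for F
      using C that by (auto simp: Chains_def relation_of_def)
    have lin: "F \<le> G \<or> G \<le> F" if "F \<in> C" "G \<in> C" for F G
      using C that by (auto simp: Chains_def relation_of_def)
    show "\<exists>u\<in>A. \<forall>a\<in>C. a \<ge> u"
    proof (cases "C = {}")
      case True
      moreover have "(cofinite :: nat filter) \<in> A"
        by (simp add: A_def cofinite_bot)
      ultimately show ?thesis by blast
    next
      case False
      have "eventually (\<lambda>_. False) (Inf C) \<longleftrightarrow> (\<exists>F\<in>C. eventually (\<lambda>_. False) F)"
        by (rule eventually_Inf_base[OF False]) (metis inf_absorb1 inf_absorb2 lin order.refl)
      with CA have "Inf C \<noteq> bot"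
        by (auto simp: A_def trivial_limit_def)
      moreover have "Inf C \<le> cofinite"
      proof -
        from False obtain F where "F \<in> C" by blast
        with CA have "Inf C \<le> F" "F \<le> cofinite" by (auto simp: A_def Inf_lower)
        then show ?thesis by (rule order_trans)
      qed
      ultimately have "Inf C \<in> A" by (simp add: A_def)
      then show ?thesis by (auto intro: Inf_lower)
    qed
  qed
  then obtain m where m: "m \<in> A" and max: "\<And>a. a \<in> A \<Longrightarrow> a \<le> m \<Longrightarrow> a = m" by blast
  have "eventually P m \<or> eventually (\<lambda>n. \<not> P n) m" for P
  proof (cases "inf m (principal {n. P n}) = bot")
    case True
    then show ?thesis by (simp add: trivial_limit_def eventually_inf_principal)
  next
    case False
    with m have "inf m (principal {n. P n}) \<in> A"
      by (auto simp: A_def intro: le_infI1)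
    then have "inf m (principal {n. P n}) = m" by (rule max) simp
    moreover have "eventually P (inf m (principal {n. P n}))"
      by (simp add: eventually_inf_principal)
    ultimately have "eventually P m" by simp
    then show ?thesis ..
  qed
  with m show ?thesis
    by (auto simp: nonprincipal_ultrafilter_def A_def)
qed

definition \<U> :: "nat filter" where
  "\<U> = (SOME F. nonprincipal_ultrafilter F)"

lemma nonprincipal_ultrafilter_\<U>: "nonprincipal_ultrafilter \<U>"
  unfolding \<U>_def using nonprincipal_ultrafilter_exists by (rule someI_ex)

lemma \<U>_neq_bot: "\<U> \<noteq> bot"
  using nonprincipal_ultrafilter_\<U> by (simp add: nonprincipal_ultrafilter_def)

lemma \<U>_ultra: "eventually P \<U> \<or> eventually (\<lambda>n. \<not> P n) \<U>"
  using nonprincipal_ultrafilter_\<U> by (simp add: nonprincipal_ultrafilter_def)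


section \<open>The hyperreal field\<close>

quotient_type hyperreal =
  "nat \<Rightarrow> real" / "\<lambda>X Y. eventually (\<lambda>n. X n = Y n) \<U>"
  morphisms rep_hyperreal hyp_class
proof (rule equivpI)
  show "reflp (\<lambda>X Y :: nat \<Rightarrow> real. eventually (\<lambda>n. X n = Y n) \<U>)"
    by (simp add: reflp_def)
  show "symp (\<lambda>X Y :: nat \<Rightarrow> real. eventually (\<lambda>n. X n = Y n) \<U>)"
    by (simp add: symp_def eq_commute)
  show "transp (\<lambda>X Y :: nat \<Rightarrow> real. eventually (\<lambda>n. X n = Y n) \<U>)"
    unfolding transp_def
  proof (intro allI impI)
    fix X Y Z :: "nat \<Rightarrow> real"
    assume "eventually (\<lambda>n. X n = Y n) \<U>" "eventually (\<lambda>n. Y n = Z n) \<U>"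
    then show "eventually (\<lambda>n. X n = Z n) \<U>" by eventually_elim simp
  qed
qed

instantiation hyperreal :: linordered_field
begin

lift_definition zero_hyperreal :: hyperreal is "\<lambda>_. 0" .

lift_definition one_hyperreal :: hyperreal is "\<lambda>_. 1" .

lift_definition plus_hyperreal :: "hyperreal \<Rightarrow> hyperreal \<Rightarrow> hyperreal"
  is "\<lambda>X Y n. X n + Y n" by (erule (1) eventually_elim2) simp

lift_definition minus_hyperreal :: "hyperreal \<Rightarrow> hyperreal \<Rightarrow> hyperreal"
  is "\<lambda>X Y n. X n - Y n" by (erule (1) eventually_elim2) simp

lift_definition uminus_hyperreal :: "hyperreal \<Rightarrow> hyperreal"
  is "\<lambda>X n. - X n" by (erule eventually_mono) simp

lift_definition times_hyperreal :: "hyperreal \<Rightarrow> hyperreal \<Rightarrow> hyperreal"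
  is "\<lambda>X Y n. X n * Y n" by (erule (1) eventually_elim2) simp

lift_definition inverse_hyperreal :: "hyperreal \<Rightarrow> hyperreal"
  is "\<lambda>X n. inverse (X n)" by (erule eventually_mono) simp

lift_definition divide_hyperreal :: "hyperreal \<Rightarrow> hyperreal \<Rightarrow> hyperreal"
  is "\<lambda>X Y n. X n / Y n" by (erule (1) eventually_elim2) simp

lift_definition less_eq_hyperreal :: "hyperreal \<Rightarrow> hyperreal \<Rightarrow> bool"
  is "\<lambda>X Y. eventually (\<lambda>n. X n \<le> Y n) \<U>"
proof -
  have *: "eventually (\<lambda>n. X' n \<le> Y' n) \<U>"
    if "eventually (\<lambda>n. X n = X' n) \<U>" "eventually (\<lambda>n. Y n = Y' n) \<U>"
      "eventually (\<lambda>n. X n \<le> Y n) \<U>" for X X' Y Y' :: "nat \<Rightarrow> real"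
    using that by eventually_elim simp
  fix X X' Y Y' :: "nat \<Rightarrow> real"
  assume "eventually (\<lambda>n. X n = X' n) \<U>" "eventually (\<lambda>n. Y n = Y' n) \<U>"
  then show "eventually (\<lambda>n. X n \<le> Y n) \<U> = eventually (\<lambda>n. X' n \<le> Y' n) \<U>"
    using *[of X X' Y Y'] *[of X' X Y' Y] by (auto simp: eq_commute)
qed

definition less_hyperreal :: "hyperreal \<Rightarrow> hyperreal \<Rightarrow> bool"
  where "x < y \<longleftrightarrow> x \<le> y \<and> \<not> y \<le> (x :: hyperreal)"

definition abs_hyperreal :: "hyperreal \<Rightarrow> hyperreal"
  where "\<bar>x\<bar> = (if x < 0 then - x else x)" for x :: hyperreal

definition sgn_hyperreal :: "hyperreal \<Rightarrow> hyperreal"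
  where "sgn x = (if x = 0 then 0 else if 0 < x then 1 else - 1)" for x :: hyperreal

instance
proof
  fix a b c :: hyperreal
  show "a + b + c = a + (b + c)" "a * b * c = a * (b * c)"
    by (transfer; simp add: algebra_simps)+
  show "a + b = b + a" "a * b = b * a" "a - b = a + - b"
    by (transfer; simp add: algebra_simps)+
  show "0 + a = a" "- a + a = 0" "1 * a = a"
    by (transfer; simp)+
  show "(a + b) * c = a * c + b * c"
    by (transfer; simp add: algebra_simps)
  show "a + b - a = b" "a - b - c = a - (b + c)" "0 * a = 0" "a * 0 = 0"
    by (transfer; simp)+
  show "(0::hyperreal) \<noteq> 1"
    by transfer (simp add: \<U>_neq_bot)
  show "inverse a * a = 1" if "a \<noteq> 0"
    using that
  proof transfer
    fix X :: "nat \<Rightarrow> real"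
    assume "\<not> eventually (\<lambda>n. X n = 0) \<U>"
    then have "eventually (\<lambda>n. X n \<noteq> 0) \<U>" using \<U>_ultra by blast
    then show "eventually (\<lambda>n. inverse (X n) * X n = 1) \<U>"
      by (rule eventually_mono) simp
  qed
  show "a div b = a * inverse b"
    by transfer (simp add: divide_inverse)
  show "inverse (0::hyperreal) = 0"
    by transfer simp
  show "(a < b) = (a \<le> b \<and> \<not> b \<le> a)"
    by (rule less_hyperreal_def)
  show "a \<le> a"
    by transfer simp
  show "a \<le> c" if "a \<le> b" "b \<le> c"
    using that by transfer (erule (1) eventually_elim2, simp)
  show "a = b" if "a \<le> b" "b \<le> a"
    using that by transfer (erule (1) eventually_elim2, simp)
  show "a \<le> b \<or> b \<le> a"
  proof transfer
    fix X Y :: "nat \<Rightarrow> real"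
    have "eventually (\<lambda>n. \<not> X n \<le> Y n) \<U> \<Longrightarrow> eventually (\<lambda>n. Y n \<le> X n) \<U>"
      by (erule eventually_mono) simp
    then show "eventually (\<lambda>n. X n \<le> Y n) \<U> \<or> eventually (\<lambda>n. Y n \<le> X n) \<U>"
      using \<U>_ultra[of "\<lambda>n. X n \<le> Y n"] by blast
  qed
  show "c + a \<le> c + b" if "a \<le> b"
    using that by transfer simp
  show "c * a < c * b" if "a < b" "0 < c"
    using that unfolding less_hyperreal_def
  proof transfer
    fix X Y Z :: "nat \<Rightarrow> real"
    assume "eventually (\<lambda>n. X n \<le> Y n) \<U> \<and> \<not> eventually (\<lambda>n. Y n \<le> X n) \<U>"
      and "eventually (\<lambda>n. 0 \<le> Z n) \<U> \<and> \<not> eventually (\<lambda>n. Z n \<le> 0) \<U>"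
    then have "eventually (\<lambda>n. \<not> Y n \<le> X n) \<U>" "eventually (\<lambda>n. \<not> Z n \<le> 0) \<U>"
      using \<U>_ultra by blast+
    then have *: "eventually (\<lambda>n. Z n * X n < Z n * Y n) \<U>"
      by eventually_elim (simp add: not_le)
    have "\<not> eventually (\<lambda>n. Z n * Y n \<le> Z n * X n) \<U>"
    proof
      assume "eventually (\<lambda>n. Z n * Y n \<le> Z n * X n) \<U>"
      with * have "eventually (\<lambda>n. False) \<U>" by eventually_elim simp
      then show False by (simp add: \<U>_neq_bot)
    qed
    then show "eventually (\<lambda>n. Z n * X n \<le> Z n * Y n) \<U> \<and>
        \<not> eventually (\<lambda>n. Z n * Y n \<le> Z n * X n) \<U>"
      using * by (auto elim: eventually_mono)
  qed
  show "\<bar>a\<bar> = (if a < 0 then - a else a)"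
    by (rule abs_hyperreal_def)
  show "sgn a = (if a = 0 then 0 else if 0 < a then 1 else - 1)"
    by (rule sgn_hyperreal_def)
qed

end

lift_definition hyp_of_real :: "real \<Rightarrow> hyperreal" is "\<lambda>r _. r" .

definition infinite_hyp :: "hyperreal \<Rightarrow> bool" where
  "infinite_hyp \<beta> \<longleftrightarrow> (\<forall>n::nat. \<bar>\<beta>\<bar> > of_nat n)"

definition finite_hyp :: "hyperreal \<Rightarrow> bool" where
  "finite_hyp \<beta> \<longleftrightarrow> \<not> infinite_hyp \<beta>"

definition infinitesimal :: "hyperreal \<Rightarrow> bool" where
  "infinitesimal \<beta> \<longleftrightarrow> (\<forall>n::nat. n \<ge> 1 \<longrightarrow> \<bar>\<beta>\<bar> < 1 / of_nat n)"

definition appreciable :: "hyperreal \<Rightarrow> bool" where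
  "appreciable \<beta> \<longleftrightarrow> \<not> infinite_hyp \<beta> \<and> \<not> infinitesimal \<beta>"


section \<open>Nonstandard extension of functions of real vectors\<close>

definition vec_class :: "(nat \<Rightarrow> real ^ 'n) \<Rightarrow> hyperreal ^ 'n" where
  "vec_class V = (\<chi> i. hyp_class (\<lambda>n. V n $ i))"

definition rep_vec :: "hyperreal ^ 'n \<Rightarrow> nat \<Rightarrow> real ^ 'n" where
  "rep_vec u n = (\<chi> i. rep_hyperreal (u $ i) n)"

definition ext2 :: "(real ^ 'n \<Rightarrow> real ^ 'n \<Rightarrow> real) \<Rightarrow>
    hyperreal ^ 'n \<Rightarrow> hyperreal ^ 'n \<Rightarrow> hyperreal" where
  "ext2 f u v = hyp_class (\<lambda>n. f (rep_vec u n) (rep_vec v n))"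

definition ext3 :: "(real ^ 'n \<Rightarrow> real ^ 'n \<Rightarrow> real ^ 'n \<Rightarrow> real) \<Rightarrow>
    hyperreal ^ 'n \<Rightarrow> hyperreal ^ 'n \<Rightarrow> hyperreal ^ 'n \<Rightarrow> hyperreal" where
  "ext3 f u v w = hyp_class (\<lambda>n. f (rep_vec u n) (rep_vec v n) (rep_vec w n))"

text \<open>The extensions do not depend on the representing sequences.\<close>

lemma rep_vec_vec_class:
  "eventually (\<lambda>n. rep_vec (vec_class V) n = V n) \<U>"
proof -
  have "eventually (\<lambda>n. rep_hyperreal (hyp_class (\<lambda>n. V n $ i)) n = V n $ i) \<U>" for i
    using Quotient3_rep_abs[OF Quotient3_hyperreal, of "\<lambda>n. V n $ i"] by simp
  then have "eventually (\<lambda>n. \<forall>i. rep_hyperreal (hyp_class (\<lambda>n. V n $ i)) n = V n $ i) \<U>"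
    by (intro eventually_all_finite)
  then show ?thesis
    by (rule eventually_mono) (simp add: rep_vec_def vec_class_def vec_eq_iff)
qed

lemma ext2_vec_class:
  "ext2 f (vec_class U) (vec_class V) = hyp_class (\<lambda>n. f (U n) (V n))"
  unfolding ext2_def hyperreal.abs_eq_iff
  using rep_vec_vec_class[of U] rep_vec_vec_class[of V] by eventually_elim simp

lemma ext3_vec_class:
  "ext3 f (vec_class U) (vec_class V) (vec_class W) = hyp_class (\<lambda>n. f (U n) (V n) (W n))"
  unfolding ext3_def hyperreal.abs_eq_iff
  using rep_vec_vec_class[of U] rep_vec_vec_class[of V] rep_vec_vec_class[of W]
  by eventually_elim simp


section \<open>Metric geometry of the projective plane\<close>

text \<open>
  Points are given by homogeneous coordinates, that is, by nonzero vectors up to a nonzero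
  scalar. A shortest segment from \<open>p\<close> to \<open>q\<close> lifts to the great circle arc on the unit sphere
  from \<open>p / norm p\<close> to that one of the two lifts of \<open>q\<close> that has nonnegative inner product
  with \<open>p\<close>.
\<close>

definition rp2_dist :: "real ^ 3 \<Rightarrow> real ^ 3 \<Rightarrow> real" where
  "rp2_dist u v = arccos (\<bar>u \<bullet> v\<bar> / (norm u * norm v))"

text \<open>
  Initial direction at \<open>p\<close> (an unnormalised vector orthogonal to \<open>p\<close>) of the shortest segment
  to \<open>q\<close>. When \<open>p\<close> and \<open>q\<close> are orthogonal there are two shortest segments and the value is the
  junk value \<open>0\<close>.
\<close>

definition side_dir :: "real ^ 3 \<Rightarrow> real ^ 3 \<Rightarrow> real ^ 3" where
  "side_dir p q = sgn (p \<bullet> q) *\<^sub>R (q - ((p \<bullet> q) / (p \<bullet> p)) *\<^sub>R p)"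

text \<open>Angle at \<open>p\<close> between the sides \<open>pq\<close> and \<open>px\<close>, with values between \<open>0\<close> and \<open>pi\<close>.\<close>

definition rp2_angle :: "real ^ 3 \<Rightarrow> real ^ 3 \<Rightarrow> real ^ 3 \<Rightarrow> real" where
  "rp2_angle p q x =
     arccos ((side_dir p q \<bullet> side_dir p x) / (norm (side_dir p q) * norm (side_dir p x)))"

text \<open>Length of the altitude from \<open>x\<close>: its distance to the line through \<open>p\<close> and \<open>q\<close>.\<close>

definition rp2_altitude :: "real ^ 3 \<Rightarrow> real ^ 3 \<Rightarrow> real ^ 3 \<Rightarrow> real" where
  "rp2_altitude x p q = (INF z \<in> span {p, q} - {0}. rp2_dist x z)"

text \<open>None of these depends on the homogeneous coordinates chosen.\<close>

lemma rp2_dist_scale: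
  assumes "a \<noteq> 0" "b \<noteq> 0"
  shows "rp2_dist (a *\<^sub>R u) (b *\<^sub>R v) = rp2_dist u v"
  using assms by (simp add: rp2_dist_def abs_mult)

lemma side_dir_scale:
  assumes "a \<noteq> 0" "b \<noteq> 0"
  shows "side_dir (a *\<^sub>R p) (b *\<^sub>R q) = (sgn a * \<bar>b\<bar>) *\<^sub>R side_dir p q"
proof -
  have "b * sgn b = \<bar>b\<bar>" by (simp add: mult_sgn_abs abs_sgn mult.commute)
  moreover have "(a * (b * (p \<bullet> q)) / (a * (a * (p \<bullet> p)))) * a = b * ((p \<bullet> q) / (p \<bullet> p))"
    using assms by simp
  then have "b *\<^sub>R q - ((a * (b * (p \<bullet> q))) / (a * (a * (p \<bullet> p)))) *\<^sub>R (a *\<^sub>R p)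
      = b *\<^sub>R (q - ((p \<bullet> q) / (p \<bullet> p)) *\<^sub>R p)"
    by (simp only: scaleR_scaleR scaleR_diff_right)
  ultimately show ?thesis
    unfolding side_dir_def
    by (simp add: sgn_mult scaleR_scaleR mult_ac del: scaleR_right_diff_distrib)
qed

lemma rp2_angle_scale:
  assumes "a \<noteq> 0" "b \<noteq> 0" "c \<noteq> 0"
  shows "rp2_angle (a *\<^sub>R p) (b *\<^sub>R q) (c *\<^sub>R x) = rp2_angle p q x"
proof -
  have "sgn a * sgn a = 1" "\<bar>sgn a\<bar> = 1" using assms by (simp_all add: sgn_if)
  with assms show ?thesis
    by (simp add: rp2_angle_def side_dir_scale abs_mult mult_ac)
qed

lemma rp2_altitude_scale:
  assumes "a \<noteq> 0" "b \<noteq> 0" "c \<noteq> 0"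
  shows "rp2_altitude (a *\<^sub>R x) (b *\<^sub>R p) (c *\<^sub>R q) = rp2_altitude x p q"
proof -
  have "b *\<^sub>R p \<in> span {p, q}" "c *\<^sub>R q \<in> span {p, q}"
    by (simp_all add: span_base span_scale)
  then have 1: "span {b *\<^sub>R p, c *\<^sub>R q} \<subseteq> span {p, q}"
    by (intro span_minimal) auto
  have "(1 / b) *\<^sub>R (b *\<^sub>R p) \<in> span {b *\<^sub>R p, c *\<^sub>R q}"
    "(1 / c) *\<^sub>R (c *\<^sub>R q) \<in> span {b *\<^sub>R p, c *\<^sub>R q}"
    by (intro span_scale span_base; simp)+
  then have 2: "span {p, q} \<subseteq> span {b *\<^sub>R p, c *\<^sub>R q}"
    using assms by (intro span_minimal) auto
  have "rp2_dist (a *\<^sub>R x) z = rp2_dist x z" for z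
    using rp2_dist_scale[of a 1 x z] assms by simp
  with 1 2 show ?thesis
    by (simp add: rp2_altitude_def subset_antisym)
qed

definition hdist :: "hyperreal ^ 3 \<Rightarrow> hyperreal ^ 3 \<Rightarrow> hyperreal" where
  "hdist = ext2 rp2_dist"

definition hangle :: "hyperreal ^ 3 \<Rightarrow> hyperreal ^ 3 \<Rightarrow> hyperreal ^ 3 \<Rightarrow> hyperreal" where
  "hangle = ext3 rp2_angle"

definition haltitude :: "hyperreal ^ 3 \<Rightarrow> hyperreal ^ 3 \<Rightarrow> hyperreal ^ 3 \<Rightarrow> hyperreal" where
  "haltitude = ext3 rp2_altitude"


section \<open>Nonstandard triangles\<close>

definition col_matrix :: "'a ^ 3 \<Rightarrow> 'a ^ 3 \<Rightarrow> 'a ^ 3 \<Rightarrow> ('a :: zero) ^ 3 ^ 3" where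
  "col_matrix u v w = transpose (vector [u, v, w])"

definition nonstandard_triangle ::
    "hyperreal ^ 3 \<Rightarrow> hyperreal ^ 3 \<Rightarrow> hyperreal ^ 3 \<Rightarrow> bool" where
  "nonstandard_triangle p q x \<longleftrightarrow> det (col_matrix p q x) \<noteq> 0"

definition on_line :: "hyperreal ^ 3 \<Rightarrow> hyperreal ^ 3 \<Rightarrow> hyperreal ^ 3 \<Rightarrow> bool" where
  "on_line y p q \<longleftrightarrow> y \<noteq> 0 \<and> (\<exists>a b. y = a *s p + b *s q)"

text \<open>The shortest altitude is the one from \<open>x\<close>, its foot is \<open>y\<close>, and \<open>p\<close> is the vertex
  on the opposite side nearer to \<open>y\<close>.\<close>

definition labelled_triangle ::
    "hyperreal ^ 3 \<Rightarrow> hyperreal ^ 3 \<Rightarrow> hyperreal ^ 3 \<Rightarrow> hyperreal ^ 3 \<Rightarrow> bool" where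
  "labelled_triangle p q x y \<longleftrightarrow>
     nonstandard_triangle p q x \<and>
     haltitude x p q \<le> haltitude p q x \<and> haltitude x p q \<le> haltitude q p x \<and>
     on_line y p q \<and> hdist x y = haltitude x p q \<and>
     hdist y p \<le> hdist y q"

definition num_infinitesimal_sides ::
    "hyperreal ^ 3 \<Rightarrow> hyperreal ^ 3 \<Rightarrow> hyperreal ^ 3 \<Rightarrow> nat" where
  "num_infinitesimal_sides p q x =
     length (filter infinitesimal [hdist p q, hdist q x, hdist x p])"

definition num_infinitesimal_angles ::
    "hyperreal ^ 3 \<Rightarrow> hyperreal ^ 3 \<Rightarrow> hyperreal ^ 3 \<Rightarrow> nat" where
  "num_infinitesimal_angles p q x =
     length (filter infinitesimal [hangle p q x, hangle q x p, hangle x p q])"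


section \<open>Groups, conjugacy and shadows\<close>

definition pos_diag :: "(hyperreal ^ 3 ^ 3) set" where
  "pos_diag = {vector [vector [a, 0, 0], vector [0, b, 0], vector [0, 0, c]] |
     a b c. a > 0 \<and> b > 0 \<and> c > 0 \<and> a * b * c = 1}"

text \<open>Conjugation by the matrix that takes the coordinate points to \<open>p\<close>, \<open>q\<close> and \<open>x\<close>.\<close>

definition triangle_group ::
    "hyperreal ^ 3 \<Rightarrow> hyperreal ^ 3 \<Rightarrow> hyperreal ^ 3 \<Rightarrow> (hyperreal ^ 3 ^ 3) set" where
  "triangle_group p q x =
     (\<lambda>D. col_matrix p q x ** D ** matrix_inv (col_matrix p q x)) ` pos_diag"

definition shadow :: "(hyperreal ^ 3 ^ 3) set \<Rightarrow> (real ^ 3 ^ 3) set" where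
  "shadow G = {A. \<exists>B\<in>G. \<forall>i j. infinitesimal (hyp_of_real (A $ i $ j) - B $ i $ j)}"

definition conjugate_SL3 :: "(real ^ 3 ^ 3) set \<Rightarrow> (real ^ 3 ^ 3) set \<Rightarrow> bool" where
  "conjugate_SL3 G H \<longleftrightarrow> (\<exists>P. det P = 1 \<and> G = (\<lambda>A. P ** A ** matrix_inv P) ` H)"

definition group_C :: "(real ^ 3 ^ 3) set" where
  "group_C = {vector [vector [a, 0, 0],
                      vector [0, b, 0],
                      vector [0, 0, 1 / (a * b)]] | a b. a > 0 \<and> b > 0}"

definition group_F :: "(real ^ 3 ^ 3) set" where
  "group_F = {vector [vector [a, t, 0],
                      vector [0, a, 0],
                      vector [0, 0, 1 / a\<^sup>2]] | a t. a > 0}"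

definition group_N1 :: "(real ^ 3 ^ 3) set" where
  "group_N1 = {vector [vector [1, s, t],
                       vector [0, 1, s],
                       vector [0, 0, 1]] | s t. True}"

definition group_N2 :: "(real ^ 3 ^ 3) set" where
  "group_N2 = {vector [vector [1, s, t],
                       vector [0, 1, 0],
                       vector [0, 0, 1]] | s t. True}"

definition group_N3 :: "(real ^ 3 ^ 3) set" where
  "group_N3 = {vector [vector [1, 0, t],
                       vector [0, 1, s],
                       vector [0, 0, 1]] | s t. True}"

definition \<Q> :: "(real ^ 3 ^ 3) set set" where
  "\<Q> = {group_C, group_F, group_N1, group_N2, group_N3}"

end

theory Submission
  imports Defs
begin

text \<open>
  Let \<open>a, b, c\<close> be the eigenvalues of an element of the triangle group at \<open>p, q, x\<close>. In the given
  normal form it is an upper triangular matrix with diagonal \<open>(a, b, c)\<close> and entries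
  \<open>u = (b - a) / \<delta>\<close>, \<open>w = \<epsilon> (c - b) / \<eta>\<close>, \<open>v = (c - a - \<epsilon> u) / \<eta>\<close> above it. Up to a normalisation of the
  determinant, the shadow therefore consists of the standard parts of the finite solutions of a
  homogeneous linear system with hyperreal coefficients. Which of the six unknowns are free in the
  limit depends only on the sizes of \<open>\<delta>\<close>, \<open>\<eta>\<close>, \<open>\<epsilon> / \<eta>\<close> and \<open>\<alpha>\<close>. The condition \<open>d(y, p) \<le> d(y, q)\<close> amounts
  to \<open>2 \<epsilon> / \<delta> + \<epsilon>\<^sup>2 \<le> 1\<close>; hence \<open>\<epsilon>\<close> is finite and \<open>1 - \<epsilon> / \<delta>\<close> is appreciable.

  If \<open>\<delta>\<close> is not infinitesimal and \<open>\<epsilon> / \<eta>\<close> is finite, the group is \<open>C\<close> or \<open>F\<close>, according to whether \<open>\<eta>\<close> is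
  infinitesimal; if \<open>\<epsilon> / \<eta>\<close> is infinite, it is \<open>N\<^sub>3\<close>. If \<open>\<delta>\<close> is infinitesimal, then so are all sides, and
  the group is \<open>N\<^sub>2\<close>, \<open>N\<^sub>1\<close> or \<open>N\<^sub>3\<close>, according to whether \<open>\<alpha>\<close> is infinitesimal, appreciable or infinite. The
  rows of the table follow by comparing sides and angles with these cases; the only angle
  estimate needed is that for finite \<open>\<epsilon> / \<eta>\<close> and infinite \<open>\<delta>\<close> the angles at \<open>p\<close> and \<open>x\<close> are not
  infinitesimal.
\<close>

section \<open>Standard parts\<close>

lemma hyp_class_cases: obtains X where "x = hyp_class X"
  using Quotient3_abs_rep[OF Quotient3_hyperreal, of x] by metis

lemmas hyp_class_simps =
  plus_hyperreal.abs_eq minus_hyperreal.abs_eq uminus_hyperreal.abs_eq times_hyperreal.abs_eq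
  inverse_hyperreal.abs_eq divide_hyperreal.abs_eq

lemma hyp_of_real_eq: "hyp_of_real r = hyp_class (\<lambda>_. r)"
  by (rule hyp_of_real.abs_eq)

lemma hyp_class_le: "hyp_class X \<le> hyp_class Y \<longleftrightarrow> eventually (\<lambda>n. X n \<le> Y n) \<U>"
  by (rule less_eq_hyperreal.abs_eq)

text \<open>An ultrafilter decides every property, so negation commutes with
  \<open>eventually\<close>; this carries the strict order from sequences to classes.\<close>

lemma not_eventually_\<U>: "\<not> eventually P \<U> \<longleftrightarrow> eventually (\<lambda>n. \<not> P n) \<U>"
proof
  show "\<not> eventually P \<U>" if "eventually (\<lambda>n. \<not> P n) \<U>"
  proof
    assume "eventually P \<U>"
    with that have "eventually (\<lambda>n. False) \<U>" by eventually_elim simp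
    then show False by (simp add: \<U>_neq_bot)
  qed
qed (use \<U>_ultra in blast)

lemma hyp_class_less: "hyp_class X < hyp_class Y \<longleftrightarrow> eventually (\<lambda>n. X n < Y n) \<U>"
  by (simp only: not_le[symmetric] hyp_class_le not_eventually_\<U>)

lemma hyp_class_abs: "\<bar>hyp_class X\<bar> = hyp_class (\<lambda>n. \<bar>X n\<bar>)"
proof -
  have "\<bar>hyp_class X\<bar> \<le> hyp_class (\<lambda>n. \<bar>X n\<bar>)"
    by (auto simp: abs_le_iff hyp_class_le uminus_hyperreal.abs_eq intro!: always_eventually)
  moreover have "hyp_class (\<lambda>n. \<bar>X n\<bar>) \<le> \<bar>hyp_class X\<bar>"
  proof (cases "0 \<le> hyp_class X")
    case True
    then have "eventually (\<lambda>n. 0 \<le> X n) \<U>" by (simp add: zero_hyperreal.abs_eq hyp_class_le)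
    with True show ?thesis by (auto simp: hyp_class_le elim: eventually_mono)
  next
    case False
    then have "hyp_class X < 0" by simp
    then have "eventually (\<lambda>n. X n < 0) \<U>" by (simp add: zero_hyperreal.abs_eq hyp_class_less)
    with False show ?thesis
      by (auto simp: hyp_class_le uminus_hyperreal.abs_eq elim: eventually_mono)
  qed
  ultimately show ?thesis by (rule order.antisym)
qed

lemma of_nat_hyperreal: "of_nat n = hyp_class (\<lambda>_. real n)"
  by (induction n) (simp_all add: zero_hyperreal.abs_eq one_hyperreal.abs_eq hyp_class_simps)

text \<open>The real \<open>r\<close> is the standard part of \<open>x\<close>. The order of the
  difference is that in \<open>shadow\<close>, so membership in a shadow unfolds to this relation
  entry by entry.\<close>

definition approx :: "hyperreal \<Rightarrow> real \<Rightarrow> bool"  (infix \<open>\<simeq>\<close> 50) where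
  "x \<simeq> r \<longleftrightarrow> infinitesimal (hyp_of_real r - x)"

text \<open>With infinitesimals read as sequences tending to 0 along \<open>\<U>\<close>, the
  arithmetic of standard parts follows from limit theorems.\<close>

lemma infinitesimal_hyp_class: "infinitesimal (hyp_class X) \<longleftrightarrow> (X \<longlongrightarrow> 0) \<U>"
proof -
  have "infinitesimal (hyp_class X) \<longleftrightarrow> (\<forall>n::nat. n \<ge> 1 \<longrightarrow> eventually (\<lambda>k. \<bar>X k\<bar> < 1 / real n) \<U>)"
    by (simp add: infinitesimal_def hyp_class_abs of_nat_hyperreal one_hyperreal.abs_eq
        hyp_class_simps hyp_class_less)
  also have "\<dots> \<longleftrightarrow> (X \<longlongrightarrow> 0) \<U>"
  proof
    assume *: "\<forall>n::nat. n \<ge> 1 \<longrightarrow> eventually (\<lambda>k. \<bar>X k\<bar> < 1 / real n) \<U>"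
    show "(X \<longlongrightarrow> 0) \<U>"
    proof (rule tendstoI)
      fix e :: real assume "e > 0"
      then obtain n where n: "1 / real (Suc n) < e"
        using nat_approx_posE by blast
      have "eventually (\<lambda>k. \<bar>X k\<bar> < 1 / real (Suc n)) \<U>" using *[rule_format, of "Suc n"] by simp
      then show "eventually (\<lambda>k. dist (X k) 0 < e) \<U>"
        by (rule eventually_mono) (use n in \<open>simp add: dist_norm del: of_nat_Suc\<close>)
    qed
  next
    assume "(X \<longlongrightarrow> 0) \<U>"
    then show "\<forall>n::nat. n \<ge> 1 \<longrightarrow> eventually (\<lambda>k. \<bar>X k\<bar> < 1 / real n) \<U>"
      by (auto simp: tendsto_iff dist_norm)
  qed
  finally show ?thesis .
qed

lemma approx_hyp_class: "hyp_class X \<simeq> r \<longleftrightarrow> (X \<longlongrightarrow> r) \<U>"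
proof -
  have "hyp_class X \<simeq> r \<longleftrightarrow> ((\<lambda>n. r - X n) \<longlongrightarrow> 0) \<U>"
    by (simp add: approx_def hyp_of_real_eq hyp_class_simps infinitesimal_hyp_class)
  also have "\<dots> \<longleftrightarrow> (X \<longlongrightarrow> r) \<U>"
    by (simp add: tendsto_iff dist_norm abs_minus_commute)
  finally show ?thesis .
qed

lemma infinitesimal_iff_approx: "infinitesimal x \<longleftrightarrow> x \<simeq> 0"
  by (cases x rule: hyp_class_cases) (simp add: infinitesimal_hyp_class approx_hyp_class)

lemma approx_hyp_of_real: "hyp_of_real r \<simeq> r"
  by (simp add: hyp_of_real_eq approx_hyp_class)

lemma approx_zero: "0 \<simeq> 0"
  by (simp add: zero_hyperreal.abs_eq approx_hyp_class)

lemma approx_one: "1 \<simeq> 1"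
  by (simp add: one_hyperreal.abs_eq approx_hyp_class)

lemma approx_add: "x \<simeq> r \<Longrightarrow> y \<simeq> s \<Longrightarrow> x + y \<simeq> r + s"
  by (cases x rule: hyp_class_cases; cases y rule: hyp_class_cases)
    (simp add: hyp_class_simps approx_hyp_class tendsto_add)

lemma approx_diff: "x \<simeq> r \<Longrightarrow> y \<simeq> s \<Longrightarrow> x - y \<simeq> r - s"
  by (cases x rule: hyp_class_cases; cases y rule: hyp_class_cases)
    (simp add: hyp_class_simps approx_hyp_class tendsto_diff)

lemma approx_mult: "x \<simeq> r \<Longrightarrow> y \<simeq> s \<Longrightarrow> x * y \<simeq> r * s"
  by (cases x rule: hyp_class_cases; cases y rule: hyp_class_cases)
    (simp add: hyp_class_simps approx_hyp_class tendsto_mult)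

lemma approx_divide: "x \<simeq> r \<Longrightarrow> y \<simeq> s \<Longrightarrow> s \<noteq> 0 \<Longrightarrow> x / y \<simeq> r / s"
  by (cases x rule: hyp_class_cases; cases y rule: hyp_class_cases)
    (simp add: hyp_class_simps approx_hyp_class tendsto_divide)

lemmas approx_intros = approx_hyp_of_real approx_zero approx_one approx_add approx_diff approx_mult

lemma approx_unique: "x \<simeq> r \<Longrightarrow> x \<simeq> s \<Longrightarrow> r = s"
  by (cases x rule: hyp_class_cases) (auto simp: approx_hyp_class dest: tendsto_unique[OF \<U>_neq_bot])

lemma approx_pos:
  assumes "x \<simeq> r" "r > 0"
  shows "x > 0"
  using assms by (cases x rule: hyp_class_cases)
    (simp add: approx_hyp_class zero_hyperreal.abs_eq hyp_class_less order_tendstoD)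

lemma approx_nonneg:
  assumes "x \<simeq> r" "x > 0"
  shows "r \<ge> 0"
proof (cases x rule: hyp_class_cases)
  case (1 X)
  with assms have "(X \<longlongrightarrow> r) \<U>" "eventually (\<lambda>n. 0 < X n) \<U>"
    by (auto simp: approx_hyp_class zero_hyperreal.abs_eq hyp_class_less)
  then show ?thesis
    by (intro tendsto_lowerbound[of X r \<U> 0]) (auto simp: \<U>_neq_bot elim: eventually_mono)
qed

section \<open>Finite hyperreals and their standard parts\<close>

lemma finite_hyp_class: "finite_hyp (hyp_class X) \<longleftrightarrow> (\<exists>n::nat. eventually (\<lambda>k. \<bar>X k\<bar> \<le> real n) \<U>)"
  by (simp add: finite_hyp_def infinite_hyp_def hyp_class_abs of_nat_hyperreal
      hyp_class_le not_less)

text \<open>Bounded sequences converge along an ultrafilter by compactness.\<close>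

lemma finite_hyp_iff_approx: "finite_hyp x \<longleftrightarrow> (\<exists>r. x \<simeq> r)"
proof (cases x rule: hyp_class_cases)
  case (1 X)
  show ?thesis
  proof
    assume "finite_hyp x"
    then obtain n :: nat where "eventually (\<lambda>k. \<bar>X k\<bar> \<le> real n) \<U>"
      by (auto simp: 1 finite_hyp_class)
    then have "eventually (\<lambda>r. r \<in> cball 0 (real n)) (filtermap X \<U>)"
      by (simp add: eventually_filtermap dist_norm)
    moreover have "filtermap X \<U> \<noteq> bot"
      by (simp add: filtermap_bot_iff \<U>_neq_bot)
    ultimately obtain r where r: "inf (nhds r) (filtermap X \<U>) \<noteq> bot"
      using compact_cball[of "0::real" "real n"] unfolding compact_filter by blast
    \<comment> \<open>A cluster point of an ultrafilter is a limit: if \<open>X\<close> did not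
      eventually lie in \<open>S\<close>, it would eventually avoid this neighbourhood of
      \<open>r\<close>.\<close>
    have "(X \<longlongrightarrow> r) \<U>"
    proof (rule topological_tendstoI)
      fix S assume S: "open S" "r \<in> S"
      show "eventually (\<lambda>k. X k \<in> S) \<U>"
      proof (rule ccontr)
        assume "\<not> ?thesis"
        then have "eventually (\<lambda>k. X k \<notin> S) \<U>" by (simp add: not_eventually_\<U>)
        moreover have "eventually (\<lambda>s. s \<in> S) (nhds r)"
          using S by (rule eventually_nhds_in_open)
        ultimately have "eventually (\<lambda>_. False) (inf (nhds r) (filtermap X \<U>))"
          unfolding eventually_inf eventually_filtermap
          by (intro exI[of _ "\<lambda>s. s \<in> S"] exI[of _ "\<lambda>s. s \<notin> S"]) auto
        with r show False by (simp add: eventually_False)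
      qed
    qed
    then show "\<exists>r. x \<simeq> r" by (auto simp: 1 approx_hyp_class)
  next
    assume "\<exists>r. x \<simeq> r"
    then obtain r where "(X \<longlongrightarrow> r) \<U>" by (auto simp: 1 approx_hyp_class)
    then have "eventually (\<lambda>k. dist (X k) r < 1) \<U>" by (simp add: tendsto_iff)
    then have "eventually (\<lambda>k. \<bar>X k\<bar> \<le> real (nat \<lceil>\<bar>r\<bar> + 1\<rceil>)) \<U>"
      by (rule eventually_mono) (simp add: dist_norm, linarith)
    then show "finite_hyp x" unfolding 1 finite_hyp_class by blast
  qed
qed

lemma finite_hyp_mult: "finite_hyp x \<Longrightarrow> finite_hyp y \<Longrightarrow> finite_hyp (x * y)"
  unfolding finite_hyp_iff_approx using approx_mult by blast

lemma infinitesimal_mult: "infinitesimal x \<Longrightarrow> finite_hyp y \<Longrightarrow> infinitesimal (x * y)"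
  unfolding finite_hyp_iff_approx infinitesimal_iff_approx using approx_mult by fastforce

lemma infinitesimal_imp_finite: "infinitesimal x \<Longrightarrow> finite_hyp x"
  unfolding finite_hyp_iff_approx infinitesimal_iff_approx by blast

lemma finite_hypI: "\<bar>x\<bar> \<le> of_nat n \<Longrightarrow> finite_hyp x"
  unfolding finite_hyp_def infinite_hyp_def using not_less by blast

lemma infinitesimal_le:
  assumes "infinitesimal y" "\<bar>x\<bar> \<le> \<bar>y\<bar>"
  shows "infinitesimal x"
  using assms unfolding infinitesimal_def by force

lemma finite_hyp_inverse:
  assumes "\<not> infinitesimal x"
  shows "finite_hyp (1 / x)"
proof -
  obtain n :: nat where n: "n \<ge> 1" "1 / of_nat n \<le> \<bar>x\<bar>"
    using assms by (auto simp: infinitesimal_def not_less)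
  moreover have "0 < 1 / (of_nat n :: hyperreal)" using n by simp
  ultimately have "0 < \<bar>x\<bar>" by linarith
  then have "\<bar>1 / x\<bar> \<le> of_nat n" using n by (simp add: abs_divide field_simps)
  then show ?thesis by (rule finite_hypI)
qed

lemma infinitesimal_inverse:
  assumes "infinite_hyp x"
  shows "1 / x \<simeq> 0"
proof -
  have "\<bar>1 / x\<bar> < 1 / of_nat n" if "n \<ge> 1" for n
  proof -
    have "of_nat n < \<bar>x\<bar>" "0 < (of_nat n :: hyperreal)"
      using assms that by (auto simp: infinite_hyp_def)
    then show ?thesis
      unfolding abs_divide abs_one by (intro divide_strict_left_mono mult_pos_pos) linarith+
  qed
  then show ?thesis by (simp add: infinitesimal_iff_approx[symmetric] infinitesimal_def)
qed

text \<open>The real cube root is total and continuous, so it acts termwise on a representing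
  sequence. It supplies the factor that restores determinant 1.\<close>

lemma cube_root_approx_one:
  assumes "x \<simeq> 1"
  obtains m where "m \<simeq> 1" "m ^ 3 = x"
proof (cases x rule: hyp_class_cases)
  case (1 X)
  have "root 3 r * root 3 r * root 3 r = r" for r
    by (simp add: odd_real_root_pow flip: power3_eq_cube)
  then have "hyp_class (\<lambda>n. root 3 (X n)) ^ 3 = x"
    by (simp add: 1 power3_eq_cube times_hyperreal.abs_eq)
  moreover have "hyp_class (\<lambda>n. root 3 (X n)) \<simeq> 1"
    using assms tendsto_real_root[of X 1 \<U> 3] by (simp add: 1 approx_hyp_class)
  ultimately show ?thesis by (rule that[rotated])
qed

section \<open>Sides and angles\<close>

text \<open>The inner product extended to hyperreal vectors. Being polynomial in the coordinates, it
  turns statements about norms and \<open>arccos\<close> into algebra in \<delta>, \<epsilon>,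
  \<eta>.\<close>

definition hdot :: "hyperreal ^ 3 \<Rightarrow> hyperreal ^ 3 \<Rightarrow> hyperreal" where
  "hdot u v = u $ 1 * v $ 1 + u $ 2 * v $ 2 + u $ 3 * v $ 3"

lemma hdot_vector [simp]:
  "hdot (vector [a, b, c]) (vector [a', b', c']) = a * a' + b * b' + c * c'"
  by (simp add: hdot_def)

lemma hdot_vec_class: "hdot (vec_class U) (vec_class V) = hyp_class (\<lambda>n. U n \<bullet> V n)"
  by (simp add: hdot_def vec_class_def inner_vec_def sum_3 hyp_class_simps)

lemma vec_class_cases: obtains U where "u = vec_class U"
proof -
  have "\<exists>X. u $ i = hyp_class X" for i
    by (cases "u $ i" rule: hyp_class_cases) blast
  then obtain X where "\<And>i. u $ i = hyp_class (X i)" by metis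
  then have "u = vec_class (\<lambda>n. \<chi> i. X i n)" by (simp add: vec_class_def vec_eq_iff)
  then show ?thesis by (rule that)
qed

text \<open>On [-1, 1] \<open>arccos\<close> is continuous with value 0 at 1, and \<open>cos\<close>
  inverts it.\<close>

lemma infinitesimal_arccos:
  assumes "\<And>n. \<bar>c n\<bar> \<le> 1"
  shows "infinitesimal (hyp_class (\<lambda>n. arccos (c n))) \<longleftrightarrow> (c \<longlongrightarrow> 1) \<U>"
  unfolding infinitesimal_hyp_class
proof
  assume "((\<lambda>n. arccos (c n)) \<longlongrightarrow> 0) \<U>"
  from tendsto_cos[OF this] show "(c \<longlongrightarrow> 1) \<U>"
    using assms by (simp add: cos_arccos_abs)
next
  assume "(c \<longlongrightarrow> 1) \<U>"
  then have "((\<lambda>n. arccos (c n)) \<longlongrightarrow> arccos 1) \<U>"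
    by (rule continuous_on_tendsto_compose[OF continuous_on_arccos'])
       (use assms in \<open>auto simp: abs_le_iff minus_le_iff intro!: always_eventually\<close>)
  then show "((\<lambda>n. arccos (c n)) \<longlongrightarrow> 0) \<U>" by simp
qed

lemma cos_dist_le_one: "\<bar>u \<bullet> v\<bar> / (norm u * norm v) \<le> 1"
  by (cases "norm u * norm v = 0")
     (use Cauchy_Schwarz_ineq2[of u v] in \<open>auto simp: divide_le_eq\<close>)

lemma cos_dist_square:
  "(\<bar>u \<bullet> v\<bar> / (norm u * norm v))\<^sup>2 = (u \<bullet> v)\<^sup>2 / ((u \<bullet> u) * (v \<bullet> v))"
  by (simp add: power_divide power_mult_distrib dot_square_norm)

text \<open>A side is infinitesimal when the cosine of its length tends to 1. Squaring the cosine
  makes it a rational function of the coordinates.\<close>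

lemma infinitesimal_hdist:
  "infinitesimal (hdist u v) \<longleftrightarrow> (hdot u v)\<^sup>2 / (hdot u u * hdot v v) \<simeq> 1"
proof (cases u rule: vec_class_cases)
  case u: (1 U)
  show ?thesis
  proof (cases v rule: vec_class_cases)
    case v: (1 V)
    let ?c = "\<lambda>n. \<bar>U n \<bullet> V n\<bar> / (norm (U n) * norm (V n))"
    have "infinitesimal (hdist u v) \<longleftrightarrow> (?c \<longlongrightarrow> 1) \<U>"
      unfolding u v hdist_def ext2_vec_class rp2_dist_def
      by (rule infinitesimal_arccos) (simp add: cos_dist_le_one)
    also have "\<dots> \<longleftrightarrow> ((\<lambda>n. (?c n)\<^sup>2) \<longlongrightarrow> 1) \<U>"
    proof
      assume "(?c \<longlongrightarrow> 1) \<U>"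
      from tendsto_power[OF this, of 2] show "((\<lambda>n. (?c n)\<^sup>2) \<longlongrightarrow> 1) \<U>" by simp
    next
      assume "((\<lambda>n. (?c n)\<^sup>2) \<longlongrightarrow> 1) \<U>"
      \<comment> \<open>The cosine of a projective distance is nonnegative, so the square root of
        its square gives it back.\<close>
      from tendsto_real_sqrt[OF this] show "(?c \<longlongrightarrow> 1) \<U>"
        by (simp add: real_sqrt_abs del: real_sqrt_mult abs_divide)
    qed
    also have "\<dots> \<longleftrightarrow> (hdot u v)\<^sup>2 / (hdot u u * hdot v v) \<simeq> 1"
      unfolding cos_dist_square
      by (simp add: u v hdot_vec_class hyp_class_simps approx_hyp_class power2_eq_square)
    finally show ?thesis .
  qed
qed

text \<open>\<open>arccos\<close> decreases, so the nearer point has the larger cosine; after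
  cancelling the norm of \<open>u\<close>, squaring removes the other norms.\<close>

lemma hdist_le_hdist_imp:
  assumes "hdist u v \<le> hdist u w" "hdot u u > 0" "hdot v v > 0" "hdot w w > 0"
  shows "(hdot u w)\<^sup>2 * hdot v v \<le> (hdot u v)\<^sup>2 * hdot w w"
proof -
  obtain U V W where uvw: "u = vec_class U" "v = vec_class V" "w = vec_class W"
    using vec_class_cases by metis
  have "eventually (\<lambda>n. rp2_dist (U n) (V n) \<le> rp2_dist (U n) (W n)) \<U>"
    "eventually (\<lambda>n. 0 < U n \<bullet> U n) \<U>" "eventually (\<lambda>n. 0 < V n \<bullet> V n) \<U>"
    "eventually (\<lambda>n. 0 < W n \<bullet> W n) \<U>"
    using assms unfolding uvw hdist_def ext2_vec_class hdot_vec_class zero_hyperreal.abs_eq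
      hyp_class_le hyp_class_less .
  then have "eventually (\<lambda>n. (U n \<bullet> W n)\<^sup>2 * (V n \<bullet> V n) \<le> (U n \<bullet> V n)\<^sup>2 * (W n \<bullet> W n)) \<U>"
  proof eventually_elim
    case (elim n)
    let ?u = "norm (U n)" and ?v = "norm (V n)" and ?w = "norm (W n)"
    have pos: "?u > 0" "?v > 0" "?w > 0" using elim by auto
    have "\<bar>U n \<bullet> W n\<bar> / (?u * ?w) \<le> \<bar>U n \<bullet> V n\<bar> / (?u * ?v)"
      using elim(1) unfolding rp2_dist_def
      by (subst (asm) arccos_le_mono) (simp_all add: cos_dist_le_one)
    then have "\<bar>U n \<bullet> W n\<bar> * ?v \<le> \<bar>U n \<bullet> V n\<bar> * ?w"
      using pos by (simp add: field_simps)
    then have "(\<bar>U n \<bullet> W n\<bar> * ?v)\<^sup>2 \<le> (\<bar>U n \<bullet> V n\<bar> * ?w)\<^sup>2"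
      by (rule power_mono) simp
    then show ?case by (simp add: power_mult_distrib dot_square_norm)
  qed
  then show ?thesis
    by (simp add: uvw hdot_vec_class power2_eq_square hyp_class_simps hyp_class_le)
qed

text \<open>The angle is that between the components of \<open>v\<close> and \<open>w\<close>
  orthogonal to \<open>u\<close>; multiplying their inner products by \<open>u \<bullet> u\<close>
  clears the denominators.\<close>

lemma cos_angle_square_le:
  fixes u v w :: "real ^ 3"
  assumes u: "u \<bullet> u > 0" and k: "0 \<le> k"
    and le: "((v \<bullet> w) * (u \<bullet> u) - (u \<bullet> v) * (u \<bullet> w))\<^sup>2 \<le>
      k * ((v \<bullet> v) * (u \<bullet> u) - (u \<bullet> v)\<^sup>2) * ((w \<bullet> w) * (u \<bullet> u) - (u \<bullet> w)\<^sup>2)"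
  shows "((side_dir u v \<bullet> side_dir u w) / (norm (side_dir u v) * norm (side_dir u w)))\<^sup>2 \<le> k"
proof -
  define v' where "v' = v - ((u \<bullet> v) / (u \<bullet> u)) *\<^sub>R u"
  define w' where "w' = w - ((u \<bullet> w) / (u \<bullet> u)) *\<^sub>R u"
  have *: "(v' \<bullet> w') * (u \<bullet> u) = (v \<bullet> w) * (u \<bullet> u) - (u \<bullet> v) * (u \<bullet> w)"
    "(v' \<bullet> v') * (u \<bullet> u) = (v \<bullet> v) * (u \<bullet> u) - (u \<bullet> v)\<^sup>2"
    "(w' \<bullet> w') * (u \<bullet> u) = (w \<bullet> w) * (u \<bullet> u) - (u \<bullet> w)\<^sup>2"
    unfolding v'_def w'_def using u
    by (simp_all add: algebra_simps inner_commute power2_eq_square)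
  have "(v' \<bullet> w')\<^sup>2 * (u \<bullet> u)\<^sup>2 \<le> k * (v' \<bullet> v') * (w' \<bullet> w') * (u \<bullet> u)\<^sup>2"
    using le unfolding *[symmetric] by (simp add: power2_eq_square mult_ac)
  then have le': "(v' \<bullet> w')\<^sup>2 \<le> k * ((v' \<bullet> v') * (w' \<bullet> w'))"
    using u by (simp add: mult_ac)
  \<comment> \<open>The signs in \<open>side_dir\<close> square to 1, or to 0 for the junk value, so
    they can only lower the left-hand side.\<close>
  have "((side_dir u v \<bullet> side_dir u w) / (norm (side_dir u v) * norm (side_dir u w)))\<^sup>2
      \<le> (v' \<bullet> w')\<^sup>2 / ((v' \<bullet> v') * (w' \<bullet> w'))"
    unfolding side_dir_def v'_def[symmetric] w'_def[symmetric]
    by (simp add: power_divide power_mult_distrib power2_norm_eq_inner sgn_if)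
  also have "\<dots> \<le> k"
    using le' k by (cases "(v' \<bullet> v') * (w' \<bullet> w') = 0") (auto simp: divide_le_eq mult_less_0_iff)
  finally show ?thesis .
qed

text \<open>The hypothesis says that the squared sine of the angle is at least \<open>1 / k\<close>.\<close>

lemma not_infinitesimal_hangle:
  fixes k :: nat
  assumes u: "hdot u u > 0" and k: "k \<ge> 1"
    and le: "of_nat k * (hdot v w * hdot u u - hdot u v * hdot u w)\<^sup>2 \<le>
      (of_nat k - 1) * ((hdot v v * hdot u u - (hdot u v)\<^sup>2) * (hdot w w * hdot u u - (hdot u w)\<^sup>2))"
  shows "\<not> infinitesimal (hangle u v w)"
proof
  assume inf: "infinitesimal (hangle u v w)"
  obtain U V W where uvw: "u = vec_class U" "v = vec_class V" "w = vec_class W"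
    using vec_class_cases by metis
  let ?c = "\<lambda>n. (side_dir (U n) (V n) \<bullet> side_dir (U n) (W n)) /
    (norm (side_dir (U n) (V n)) * norm (side_dir (U n) (W n)))"
  have "\<bar>?c n\<bar> \<le> 1" for n
    using cos_dist_le_one[of "side_dir (U n) (V n)" "side_dir (U n) (W n)"]
    by (simp add: abs_divide abs_mult)
  then have "(?c \<longlongrightarrow> 1) \<U>"
    using inf unfolding uvw hangle_def ext3_vec_class rp2_angle_def
    by (subst (asm) infinitesimal_arccos)
  from tendsto_power[OF this, of 2] have lim: "((\<lambda>n. (?c n)\<^sup>2) \<longlongrightarrow> 1) \<U>" by simp
  have "eventually (\<lambda>n. U n \<bullet> U n > 0) \<U>"
    using u by (simp add: uvw hdot_vec_class zero_hyperreal.abs_eq hyp_class_less)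
  moreover have "eventually (\<lambda>n. real k * ((V n \<bullet> W n) * (U n \<bullet> U n) - (U n \<bullet> V n) * (U n \<bullet> W n))\<^sup>2
      \<le> (real k - 1) * (((V n \<bullet> V n) * (U n \<bullet> U n) - (U n \<bullet> V n)\<^sup>2)
        * ((W n \<bullet> W n) * (U n \<bullet> U n) - (U n \<bullet> W n)\<^sup>2))) \<U>"
    using le by (simp add: uvw hdot_vec_class power2_eq_square of_nat_hyperreal one_hyperreal.abs_eq
        hyp_class_simps hyp_class_le)
  ultimately have "eventually (\<lambda>n. (?c n)\<^sup>2 \<le> 1 - 1 / real k) \<U>"
  proof eventually_elim
    case (elim n)
    show ?case
    proof (rule cos_angle_square_le[OF elim(1)])
      show "0 \<le> 1 - 1 / real k" using k by simp
      show "((V n \<bullet> W n) * (U n \<bullet> U n) - (U n \<bullet> V n) * (U n \<bullet> W n))\<^sup>2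
        \<le> (1 - 1 / real k) * ((V n \<bullet> V n) * (U n \<bullet> U n) - (U n \<bullet> V n)\<^sup>2)
          * ((W n \<bullet> W n) * (U n \<bullet> U n) - (U n \<bullet> W n)\<^sup>2)" (is "?l \<le> _ * ?a * ?b")
      proof -
        have "?l \<le> (real k - 1) * (?a * ?b) / real k"
          using elim(2) k by (simp add: pos_le_divide_eq mult.commute)
        also have "\<dots> = (1 - 1 / real k) * ?a * ?b" using k by (simp add: field_simps)
        finally show ?thesis .
      qed
    qed
  qed
  from tendsto_upperbound[OF lim this \<U>_neq_bot] show False using k by simp
qed

text \<open>It is not known beforehand that \<open>x\<close> has a standard part. If
  \<open>x\<close> is not infinitesimal, \<open>1 / x\<close> is finite, and
  \<open>x = x\<^sup>2 * (1 / x)\<close> would be infinitesimal.\<close>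

lemma approx_square_zero:
  assumes "x\<^sup>2 \<simeq> 0"
  shows "x \<simeq> 0"
proof (rule ccontr)
  assume *: "\<not> x \<simeq> 0"
  then have "x \<noteq> 0" by (auto simp: approx_zero)
  from * have "finite_hyp (1 / x)" by (simp add: finite_hyp_inverse infinitesimal_iff_approx)
  with assms have "infinitesimal (x\<^sup>2 * (1 / x))"
    by (intro infinitesimal_mult) (simp_all add: infinitesimal_iff_approx)
  with * \<open>x \<noteq> 0\<close> show False by (simp add: power2_eq_square infinitesimal_iff_approx)
qed

lemma approx_inverse_one:
  assumes "1 / x \<simeq> 1"
  shows "x \<simeq> 1"
  using approx_divide[OF approx_one assms] by simp

lemma approx_one_minus: "1 - x \<simeq> 0 \<longleftrightarrow> x \<simeq> 1"
  using approx_diff[OF approx_one, of x 1] approx_diff[OF approx_one, of "1 - x" 0] by auto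

section \<open>Sides and angles in the normal form\<close>

lemma infinitesimal_side_pq:
  "infinitesimal (hdist (vector [1, 0, 0]) (vector [1, \<delta>, 0])) \<longleftrightarrow> infinitesimal \<delta>"
proof -
  have "1 / (1 + \<delta>\<^sup>2) \<simeq> 1 \<longleftrightarrow> \<delta> \<simeq> 0"
  proof
    assume "1 / (1 + \<delta>\<^sup>2) \<simeq> 1"
    from approx_diff[OF approx_inverse_one[OF this] approx_one] show "\<delta> \<simeq> 0"
      by (simp add: approx_square_zero)
  next
    assume "\<delta> \<simeq> 0"
    from approx_divide[OF approx_one approx_add[OF approx_one approx_mult[OF this this]]]
    show "1 / (1 + \<delta>\<^sup>2) \<simeq> 1" by (simp add: power2_eq_square)
  qed
  then show ?thesis
    unfolding infinitesimal_hdist unfolding infinitesimal_iff_approx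
    by (simp add: power2_eq_square)
qed

lemma infinitesimal_side_xp:
  assumes "infinitesimal \<epsilon>" "infinitesimal \<eta>"
  shows "infinitesimal (hdist (vector [1, \<epsilon>, \<eta>]) (vector [1, 0, 0]))"
proof -
  have "1 + \<epsilon> * \<epsilon> + \<eta> * \<eta> \<simeq> 1 + 0 * 0 + 0 * 0"
    using assms by (intro approx_intros) (simp_all add: infinitesimal_iff_approx)
  from approx_divide[OF approx_one this] show ?thesis by (simp add: infinitesimal_hdist)
qed

text \<open>The bound on \<open>z\<close> is the squared cosine of the distance from \<open>x\<close> to the line \<open>pq\<close>.\<close>

lemma not_approx_one_of_distance:
  fixes z :: hyperreal
  assumes "\<not> infinitesimal \<eta>" "finite_hyp (\<epsilon> / \<eta>)"
    and "z \<le> (1 + \<epsilon>\<^sup>2) / (1 + \<epsilon>\<^sup>2 + \<eta>\<^sup>2)"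
  shows "\<not> z \<simeq> 1"
proof
  assume "z \<simeq> 1"
  have "\<eta> \<noteq> 0" using assms(1) by (auto simp: infinitesimal_iff_approx approx_zero)
  define N where "N = 1 + \<epsilon>\<^sup>2 + \<eta>\<^sup>2"
  have N: "N > 0" unfolding N_def by (intro add_pos_nonneg) auto
  \<comment> \<open>\<open>\<eta>\<^sup>2 / N\<close> is the squared sine of the distance from
    \<open>x\<close> to the line; it would be infinitesimal although its reciprocal is
    finite.\<close>
  have "\<eta>\<^sup>2 / N \<le> 1 - z" "0 \<le> \<eta>\<^sup>2 / N"
    using assms(3) N unfolding N_def[symmetric] by (simp_all add: N_def field_simps)
  moreover have "infinitesimal (1 - z)"
    using \<open>z \<simeq> 1\<close> by (simp add: infinitesimal_iff_approx approx_one_minus)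
  ultimately have 1: "infinitesimal (\<eta>\<^sup>2 / N)"
    by (auto intro: infinitesimal_le)
  have "finite_hyp (1 / \<eta>)" using assms(1) by (rule finite_hyp_inverse)
  then obtain r s where "1 / \<eta> \<simeq> r" "\<epsilon> / \<eta> \<simeq> s"
    using assms(2) by (auto simp: finite_hyp_iff_approx)
  then have "(1 / \<eta>) * (1 / \<eta>) + (\<epsilon> / \<eta>) * (\<epsilon> / \<eta>) + 1 \<simeq> r * r + s * s + 1"
    by (intro approx_intros)
  also have "(1 / \<eta>) * (1 / \<eta>) + (\<epsilon> / \<eta>) * (\<epsilon> / \<eta>) + 1 = N / \<eta>\<^sup>2"
    using \<open>\<eta> \<noteq> 0\<close> by (simp add: N_def field_simps power2_eq_square)
  finally have "finite_hyp (N / \<eta>\<^sup>2)" by (auto simp: finite_hyp_iff_approx)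
  with 1 have "infinitesimal (\<eta>\<^sup>2 / N * (N / \<eta>\<^sup>2))" by (rule infinitesimal_mult)
  with N \<open>\<eta> \<noteq> 0\<close> have "1 \<simeq> 0" by (simp add: infinitesimal_iff_approx)
  then show False using approx_one approx_unique by fastforce
qed

lemma not_infinitesimal_side_xp:
  assumes "\<not> infinitesimal \<eta>" "finite_hyp (\<epsilon> / \<eta>)"
  shows "\<not> infinitesimal (hdist (vector [1, \<epsilon>, \<eta>]) (vector [1, 0, 0]))"
proof -
  have "1 / (1 + \<epsilon>\<^sup>2 + \<eta>\<^sup>2) \<le> (1 + \<epsilon>\<^sup>2) / (1 + \<epsilon>\<^sup>2 + \<eta>\<^sup>2)"
    by (intro divide_right_mono) auto
  from not_approx_one_of_distance[OF assms this] show ?thesis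
    by (simp add: infinitesimal_hdist power2_eq_square)
qed

text \<open>Since \<open>q\<close> lies on the line \<open>pq\<close>, it is at least as far from
  \<open>x\<close> as the line is; in formulas this is the Cauchy-Schwarz inequality for (1,
  \<delta>) and (1, \<epsilon>).\<close>

lemma not_infinitesimal_side_qx:
  assumes "\<not> infinitesimal \<eta>" "finite_hyp (\<epsilon> / \<eta>)"
  shows "\<not> infinitesimal (hdist (vector [1, \<delta>, 0]) (vector [1, \<epsilon>, \<eta>]))"
proof -
  have pos: "1 + \<delta>\<^sup>2 > 0" "1 + \<epsilon>\<^sup>2 + \<eta>\<^sup>2 > 0" by (intro add_pos_nonneg; simp)+
  have "(1 + \<delta> * \<epsilon>)\<^sup>2 \<le> (1 + \<epsilon>\<^sup>2) * (1 + \<delta>\<^sup>2)"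
    using zero_le_square[of "\<delta> - \<epsilon>"] by (simp add: algebra_simps power2_eq_square)
  then have "(1 + \<delta> * \<epsilon>)\<^sup>2 / ((1 + \<delta>\<^sup>2) * (1 + \<epsilon>\<^sup>2 + \<eta>\<^sup>2)) \<le> (1 + \<epsilon>\<^sup>2) / (1 + \<epsilon>\<^sup>2 + \<eta>\<^sup>2)"
    using pos by (simp add: divide_le_eq)
  from not_approx_one_of_distance[OF assms this] show ?thesis
    by (simp add: infinitesimal_hdist power2_eq_square)
qed

text \<open>Finiteness of the ratio in the polynomial form that the angle criterion takes.\<close>

lemma finite_ratio_bound:
  assumes "finite_hyp (\<epsilon> / \<eta>)" "\<eta> \<noteq> 0"
  obtains m :: nat where "\<epsilon>\<^sup>2 \<le> of_nat m * \<eta>\<^sup>2"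
proof -
  obtain n :: nat where "\<bar>\<epsilon> / \<eta>\<bar> \<le> of_nat n"
    using assms(1) by (auto simp: finite_hyp_def infinite_hyp_def not_less)
  then have "\<bar>\<epsilon>\<bar> \<le> \<bar>of_nat n * \<eta>\<bar>"
    using assms(2) by (simp add: abs_divide abs_mult divide_le_eq)
  then have "\<epsilon>\<^sup>2 \<le> of_nat (n\<^sup>2) * \<eta>\<^sup>2"
    unfolding abs_le_square_iff by (simp add: power_mult_distrib)
  then show ?thesis by (rule that)
qed

text \<open>The directions at \<open>p\<close> to \<open>q\<close> and \<open>x\<close> are
  (\<delta>, 0) and (\<epsilon>, \<eta>), so the squared sine is
  \<open>\<eta>\<^sup>2 / (\<epsilon>\<^sup>2 + \<eta>\<^sup>2)\<close>, at least
  \<open>1 / (m + 1)\<close>.\<close>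

lemma not_infinitesimal_angle_p:
  assumes "finite_hyp (\<epsilon> / \<eta>)" "\<eta> \<noteq> 0"
  shows "\<not> infinitesimal (hangle (vector [1, 0, 0]) (vector [1, \<delta>, 0]) (vector [1, \<epsilon>, \<eta>]))"
proof -
  obtain m :: nat where m: "\<epsilon>\<^sup>2 \<le> of_nat m * \<eta>\<^sup>2"
    using assms by (rule finite_ratio_bound)
  then have "(\<epsilon>\<^sup>2 + of_nat m * \<epsilon>\<^sup>2) * \<delta>\<^sup>2 \<le> (of_nat m * \<eta>\<^sup>2 + of_nat m * \<epsilon>\<^sup>2) * \<delta>\<^sup>2"
    by (intro mult_right_mono add_right_mono) auto
  then show ?thesis
    by (intro not_infinitesimal_hangle[of _ "Suc m"])
       (simp_all add: algebra_simps power2_eq_square)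
qed

text \<open>The squared sine is \<open>(X - Y) / X\<close>, where \<open>X\<close> is the product of
  the Gram determinants of \<open>x\<close> with \<open>p\<close> and with \<open>q\<close>; the aim
  is the lower bound \<open>1 / (4 * M)\<close>.\<close>

lemma not_infinitesimal_angle_x:
  assumes "finite_hyp (\<epsilon> / \<eta>)" "\<eta> \<noteq> 0" "\<bar>\<epsilon>\<bar> \<le> \<bar>\<delta>\<bar>" "1 \<le> \<bar>\<delta>\<bar>"
  shows "\<not> infinitesimal (hangle (vector [1, \<epsilon>, \<eta>]) (vector [1, 0, 0]) (vector [1, \<delta>, 0]))"
proof -
  obtain m :: nat where m: "\<epsilon>\<^sup>2 \<le> of_nat m * \<eta>\<^sup>2"
    using assms(1,2) by (rule finite_ratio_bound)
  define M :: hyperreal where "M = 1 + of_nat m"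
  define N where "N = 1 + \<epsilon>\<^sup>2 + \<eta>\<^sup>2"
  define X where "X = (N - 1) * ((1 + \<delta>\<^sup>2) * N - (1 + \<epsilon> * \<delta>)\<^sup>2)"
  define Y where "Y = (N - (1 + \<epsilon> * \<delta>))\<^sup>2"
  have N: "N > 0" unfolding N_def by (intro add_pos_nonneg) auto
  \<comment> \<open>A Gram identity: the difference is \<open>N\<close> times the square of
    \<open>\<delta> * \<eta>\<close>, the determinant of \<open>p, q, x\<close>.\<close>
  have "X - Y = \<delta>\<^sup>2 * \<eta>\<^sup>2 * N"
    unfolding X_def Y_def N_def by (simp add: algebra_simps power2_eq_square)
  \<comment> \<open>The factor 4 comes from
    \<open>(\<delta> - \<epsilon>)\<^sup>2 \<le> 4 * \<delta>\<^sup>2\<close>.\<close>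
  moreover have "X \<le> (M * \<eta>\<^sup>2) * (4 * \<delta>\<^sup>2 * N)"
    unfolding X_def
  proof (rule mult_mono)
    show "N - 1 \<le> M * \<eta>\<^sup>2" using m by (simp add: N_def M_def algebra_simps)
    have d: "1 \<le> \<delta>\<^sup>2" "\<epsilon>\<^sup>2 \<le> \<delta>\<^sup>2"
      using assms(3,4) abs_le_square_iff[of 1 \<delta>] abs_le_square_iff[of \<epsilon> \<delta>] by simp_all
    then have "\<eta>\<^sup>2 * 1 \<le> \<eta>\<^sup>2 * \<delta>\<^sup>2" "0 \<le> \<epsilon>\<^sup>2 * \<delta>\<^sup>2" "0 \<le> \<eta>\<^sup>2 * \<delta>\<^sup>2"
      by (intro mult_left_mono) auto
    moreover have "(1 + \<delta>\<^sup>2) * N - (1 + \<epsilon> * \<delta>)\<^sup>2 = \<eta>\<^sup>2 + \<eta>\<^sup>2 * \<delta>\<^sup>2 + (\<delta> - \<epsilon>)\<^sup>2"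
      unfolding N_def by (simp add: algebra_simps power2_eq_square)
    moreover have "(\<delta> - \<epsilon>)\<^sup>2 = 2 * \<delta>\<^sup>2 + 2 * \<epsilon>\<^sup>2 - (\<delta> + \<epsilon>)\<^sup>2"
      by (simp add: algebra_simps power2_eq_square)
    moreover have "4 * \<delta>\<^sup>2 * N = 4 * \<delta>\<^sup>2 + 4 * (\<epsilon>\<^sup>2 * \<delta>\<^sup>2) + 4 * (\<eta>\<^sup>2 * \<delta>\<^sup>2)"
      unfolding N_def by (simp add: algebra_simps)
    moreover have "(\<delta> + \<epsilon>)\<^sup>2 \<ge> 0" "(\<delta> - \<epsilon>)\<^sup>2 \<ge> 0" "\<eta>\<^sup>2 \<ge> 0" by simp_all
    ultimately show "(1 + \<delta>\<^sup>2) * N - (1 + \<epsilon> * \<delta>)\<^sup>2 \<le> 4 * \<delta>\<^sup>2 * N"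
      "0 \<le> (1 + \<delta>\<^sup>2) * N - (1 + \<epsilon> * \<delta>)\<^sup>2"
      using d by linarith+
    show "0 \<le> M * \<eta>\<^sup>2" by (simp add: M_def)
  qed
  moreover have "(M * \<eta>\<^sup>2) * (4 * \<delta>\<^sup>2 * N) = 4 * M * (\<delta>\<^sup>2 * \<eta>\<^sup>2 * N)" by simp
  ultimately have "X \<le> 4 * M * (X - Y)" by simp
  then have "4 * M * Y \<le> (4 * M - 1) * X" by (simp add: algebra_simps)
  moreover have "of_nat (4 * Suc m) = 4 * M" by (simp add: M_def)
  ultimately show ?thesis
    using N unfolding X_def Y_def N_def
    by (intro not_infinitesimal_hangle[of _ "4 * Suc m"])
       (simp_all add: power2_eq_square add.assoc mult_ac del: of_nat_Suc of_nat_mult)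
qed

text \<open>Comparing squared cosines gives \<open>(1 + \<epsilon> * \<delta>)\<^sup>2 \<le> 1 +
  \<delta>\<^sup>2\<close>; expanding and dividing by \<open>\<delta>\<^sup>2\<close> leaves the
  claim.\<close>

lemma nearer_vertex_imp:
  assumes "hdist (vector [1, \<epsilon>, 0]) (vector [1, 0, 0]) \<le> hdist (vector [1, \<epsilon>, 0]) (vector [1, \<delta>, 0])"
    and "\<delta> \<noteq> 0"
  shows "2 * (\<epsilon> / \<delta>) + \<epsilon>\<^sup>2 \<le> 1"
proof -
  have "1 + z * z > 0" for z :: hyperreal by (intro add_pos_nonneg) auto
  with hdist_le_hdist_imp[OF assms(1)] have "(1 + \<epsilon> * \<delta>)\<^sup>2 \<le> 1 + \<delta>\<^sup>2"
    by (simp add: power2_eq_square)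
  moreover have "(\<epsilon> / \<delta>) * \<delta>\<^sup>2 = \<epsilon> * \<delta>"
    using assms(2) by (simp add: power2_eq_square)
  then have "(2 * (\<epsilon> / \<delta>) + \<epsilon>\<^sup>2) * \<delta>\<^sup>2 = (1 + \<epsilon> * \<delta>)\<^sup>2 - 1"
    by (simp only: distrib_right mult.assoc) (simp add: power2_eq_square algebra_simps)
  ultimately have "(2 * (\<epsilon> / \<delta>) + \<epsilon>\<^sup>2) * \<delta>\<^sup>2 \<le> 1 * \<delta>\<^sup>2" by simp
  then show ?thesis using assms(2) by (simp only: mult_le_cancel_right) simp
qed

section \<open>Shadows of triangle groups\<close>

definition upper :: "'a \<Rightarrow> 'a \<Rightarrow> 'a \<Rightarrow> 'a \<Rightarrow> 'a \<Rightarrow> 'a \<Rightarrow> ('a :: zero) ^ 3 ^ 3" where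
  "upper a u v b w c = vector [vector [a, u, v], vector [0, b, w], vector [0, 0, c]]"

lemma upper_eq_iff [simp]:
  "upper a u v b w c = upper a' u' v' b' w' c' \<longleftrightarrow>
     a = a' \<and> u = u' \<and> v = v' \<and> b = b' \<and> w = w' \<and> c = c'"
  by (auto simp: upper_def vec_eq_iff forall_3)

lemma upper_mult:
  "upper a u v b w c ** upper a' u' v' b' w' c' =
     upper (a * a') (a * u' + u * b') (a * v' + u * w' + v * c') (b * b') (b * w' + w * c') (c * c')"
  for a :: "'a :: semiring_1"
  by (simp add: upper_def matrix_matrix_mult_def vec_eq_iff forall_3 sum_3)

lemma det_upper: "det (upper a u v b w c) = a * b * c" for a :: "'a :: comm_ring_1"
  by (simp add: upper_def det_3)

lemma matrix_inv_invertible: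
  "invertible A \<Longrightarrow> A ** matrix_inv A = mat 1 \<and> matrix_inv A ** A = mat 1"
  unfolding matrix_inv_def invertible_def by (rule someI_ex)

text \<open>Replaces the inverse by an equation between products, which can be checked entry by
  entry.\<close>

lemma conjugate_eq_iff:
  fixes P D M :: "('a :: field) ^ 'n ^ 'n"
  assumes "det P \<noteq> 0"
  shows "P ** D ** matrix_inv P = M \<longleftrightarrow> M ** P = P ** D"
proof -
  have P: "invertible P" using assms by (simp add: invertible_det_nz)
  show ?thesis
  proof
    assume "P ** D ** matrix_inv P = M"
    then have "M ** P = P ** D ** (matrix_inv P ** P)" by (simp add: matrix_mul_assoc)
    with P show "M ** P = P ** D" by (simp add: matrix_inv_invertible)
  next
    assume "M ** P = P ** D"
    then have "P ** D ** matrix_inv P = M ** (P ** matrix_inv P)" by (simp add: matrix_mul_assoc)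
    with P show "P ** D ** matrix_inv P = M" by (simp add: matrix_inv_invertible)
  qed
qed

lemma conjugate_SL3I:
  assumes "det P = 1"
    and "\<And>A. A \<in> H \<Longrightarrow> \<exists>B\<in>G. B ** P = P ** A"
    and "\<And>B. B \<in> G \<Longrightarrow> \<exists>A\<in>H. B ** P = P ** A"
  shows "conjugate_SL3 G H"
proof -
  have "P ** A ** matrix_inv P = B \<longleftrightarrow> B ** P = P ** A" for A B
    using assms(1) by (intro conjugate_eq_iff) simp
  then have "G = (\<lambda>A. P ** A ** matrix_inv P) ` H"
    using assms(2,3) by (metis (no_types, lifting) image_eqI subsetI subset_antisym image_subsetI)
  with assms(1) show ?thesis by (auto simp: conjugate_SL3_def)
qed

text \<open>The upper triangular matrix with rows \<open>(a, u, v)\<close>, \<open>(0, b, w)\<close>, \<open>(0, 0, c)\<close> has \<open>p\<close>, \<open>q\<close>, \<open>x\<close> as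
  eigenvectors, with eigenvalues \<open>a\<close>, \<open>b\<close>, \<open>c\<close>.\<close>

definition eigen_relation ::
    "hyperreal \<Rightarrow> hyperreal \<Rightarrow> hyperreal \<Rightarrow> hyperreal \<Rightarrow> hyperreal \<Rightarrow> hyperreal \<Rightarrow>
     hyperreal \<Rightarrow> hyperreal \<Rightarrow> hyperreal \<Rightarrow> bool" where
  "eigen_relation \<delta> \<epsilon> \<eta> a u v b w c \<longleftrightarrow>
     b - a = \<delta> * u \<and> \<epsilon> * (c - b) = \<eta> * w \<and> c - a = \<eta> * v + \<epsilon> * u"

lemma triangle_group_iff:
  assumes "\<delta> \<noteq> 0" "\<eta> \<noteq> 0"
  shows "M \<in> triangle_group (vector [1, 0, 0]) (vector [1, \<delta>, 0]) (vector [1, \<epsilon>, \<eta>]) \<longleftrightarrow>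
    (\<exists>a u v b w c. M = upper a u v b w c \<and> eigen_relation \<delta> \<epsilon> \<eta> a u v b w c \<and>
       a > 0 \<and> b > 0 \<and> c > 0 \<and> a * b * c = 1)"
proof -
  define P where "P = upper 1 1 1 \<delta> \<epsilon> \<eta>"
  have P: "col_matrix (vector [1, 0, 0]) (vector [1, \<delta>, 0]) (vector [1, \<epsilon>, \<eta>]) = P"
    by (simp add: P_def col_matrix_def upper_def transpose_def vec_eq_iff forall_3)
  have "det P \<noteq> 0" using assms by (simp add: P_def det_upper)
  then have conj: "P ** D ** matrix_inv P = M \<longleftrightarrow> M ** P = P ** D" for D M
    by (rule conjugate_eq_iff)
  \<comment> \<open>Column by column, the matrix equation says that \<open>p\<close>,
    \<open>q\<close>, \<open>x\<close> are eigenvectors.\<close>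
  have rel: "upper a u v b w c ** P = P ** upper a 0 0 b 0 c \<longleftrightarrow> eigen_relation \<delta> \<epsilon> \<eta> a u v b w c"
    for a u v b w c
    by (auto simp: P_def upper_mult eigen_relation_def algebra_simps)
  have ex: "\<exists>u v w. eigen_relation \<delta> \<epsilon> \<eta> a u v b w c" for a b c
    using assms by (intro exI[of _ "(b - a) / \<delta>"] exI[of _ "(c - a - \<epsilon> * ((b - a) / \<delta>)) / \<eta>"]
        exI[of _ "\<epsilon> * (c - b) / \<eta>"]) (simp add: eigen_relation_def)
  have "M \<in> triangle_group (vector [1, 0, 0]) (vector [1, \<delta>, 0]) (vector [1, \<epsilon>, \<eta>]) \<longleftrightarrow>
    (\<exists>a b c. P ** upper a 0 0 b 0 c ** matrix_inv P = M \<and> a > 0 \<and> b > 0 \<and> c > 0 \<and> a * b * c = 1)"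
    unfolding triangle_group_def P pos_diag_def upper_def by blast
  also have "\<dots> \<longleftrightarrow> (\<exists>a u v b w c. M = upper a u v b w c \<and> eigen_relation \<delta> \<epsilon> \<eta> a u v b w c \<and>
       a > 0 \<and> b > 0 \<and> c > 0 \<and> a * b * c = 1)"
    by (metis conj rel ex)
  finally show ?thesis .
qed

section \<open>Limits of the eigenvalue relations\<close>

definition limit_relation ::
    "hyperreal \<Rightarrow> hyperreal \<Rightarrow> hyperreal \<Rightarrow> real \<Rightarrow> real \<Rightarrow> real \<Rightarrow> real \<Rightarrow> real \<Rightarrow> real \<Rightarrow> bool" where
  "limit_relation \<delta> \<epsilon> \<eta> a u v b w c \<longleftrightarrow>
     (\<exists>a' u' v' b' w' c'. eigen_relation \<delta> \<epsilon> \<eta> a' u' v' b' w' c' \<and>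
        a' \<simeq> a \<and> u' \<simeq> u \<and> v' \<simeq> v \<and> b' \<simeq> b \<and> w' \<simeq> w \<and> c' \<simeq> c)"

lemma eigen_relation_divide:
  assumes "eigen_relation \<delta> \<epsilon> \<eta> a u v b w c"
  shows "eigen_relation \<delta> \<epsilon> \<eta> (a / m) (u / m) (v / m) (b / m) (w / m) (c / m)"
  using assms unfolding eigen_relation_def
  by (simp add: diff_divide_distrib[symmetric] add_divide_distrib[symmetric])

text \<open>The equation \<open>det = 1\<close> is only needed for the standard parts, since the eigenvalue relations
  are homogeneous and one can divide by a cube root of the determinant.\<close>

lemma shadow_triangle_group:
  assumes "\<delta> \<noteq> 0" "\<eta> \<noteq> 0"
  shows "shadow (triangle_group (vector [1, 0, 0]) (vector [1, \<delta>, 0]) (vector [1, \<epsilon>, \<eta>])) =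
    {upper a u v b w c | a u v b w c. limit_relation \<delta> \<epsilon> \<eta> a u v b w c \<and>
       a > 0 \<and> b > 0 \<and> c > 0 \<and> a * b * c = 1}" (is "shadow ?G = ?S")
proof (intro subset_antisym subsetI)
  fix A assume "A \<in> shadow ?G"
  then obtain a' u' v' b' w' c' where rel: "eigen_relation \<delta> \<epsilon> \<eta> a' u' v' b' w' c'"
    and pos: "a' > 0" "b' > 0" "c' > 0" and one: "a' * b' * c' = 1"
    and ap: "\<And>i j. upper a' u' v' b' w' c' $ i $ j \<simeq> A $ i $ j"
    unfolding shadow_def Bex_def triangle_group_iff[OF assms] approx_def by blast
  have ap': "a' \<simeq> A$1$1" "u' \<simeq> A$1$2" "v' \<simeq> A$1$3" "b' \<simeq> A$2$2" "w' \<simeq> A$2$3" "c' \<simeq> A$3$3"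
    "0 \<simeq> A$2$1" "0 \<simeq> A$3$1" "0 \<simeq> A$3$2"
    using ap[of 1 1] ap[of 1 2] ap[of 1 3] ap[of 2 1] ap[of 2 2] ap[of 2 3]
      ap[of 3 1] ap[of 3 2] ap[of 3 3] by (simp_all add: upper_def)
  have "A = upper (A$1$1) (A$1$2) (A$1$3) (A$2$2) (A$2$3) (A$3$3)"
    using ap'(7-9)[THEN approx_unique[OF approx_zero]]
    by (simp add: upper_def vec_eq_iff forall_3)
  moreover have "limit_relation \<delta> \<epsilon> \<eta> (A$1$1) (A$1$2) (A$1$3) (A$2$2) (A$2$3) (A$3$3)"
    using rel ap' unfolding limit_relation_def by blast
  moreover have "A$1$1 * A$2$2 * A$3$3 = 1"
    using approx_mult[OF approx_mult[OF ap'(1,4)] ap'(6)] approx_one one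
    by (auto dest: approx_unique)
  \<comment> \<open>Limits of positive eigenvalues are only nonnegative; the product 1 then excludes
    0.\<close>
  moreover have "A$1$1 \<ge> 0" "A$2$2 \<ge> 0" "A$3$3 \<ge> 0"
    using ap'(1,4,6) pos by (auto intro: approx_nonneg)
  ultimately show "A \<in> ?S"
    by (smt (verit) mem_Collect_eq mult_eq_0_iff)
next
  fix A assume "A \<in> ?S"
  then obtain a u v b w c where A: "A = upper a u v b w c"
    and lim: "limit_relation \<delta> \<epsilon> \<eta> a u v b w c"
    and pos: "a > 0" "b > 0" "c > 0" and one: "a * b * c = 1" by blast
  from lim obtain a' u' v' b' w' c' where rel: "eigen_relation \<delta> \<epsilon> \<eta> a' u' v' b' w' c'"
    and ap: "a' \<simeq> a" "u' \<simeq> u" "v' \<simeq> v" "b' \<simeq> b" "w' \<simeq> w" "c' \<simeq> c"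
    unfolding limit_relation_def by blast
  have "a' * b' * c' \<simeq> 1"
    using approx_mult[OF approx_mult[OF ap(1,4)] ap(6)] one by simp
  then obtain m where m: "m \<simeq> 1" "m ^ 3 = a' * b' * c'" by (rule cube_root_approx_one)
  have "m > 0" using m(1) by (rule approx_pos) simp
  have ap': "x / m \<simeq> r" if "x \<simeq> r" for x r
    using approx_divide[OF that m(1)] by simp
  have pos': "a' / m > 0" "b' / m > 0" "c' / m > 0"
    using ap' ap pos approx_pos by blast+
  then have "a' \<noteq> 0" "b' \<noteq> 0" "c' \<noteq> 0" by auto
  then have "(a' / m) * (b' / m) * (c' / m) = 1"
    using m(2) \<open>m > 0\<close> by (simp add: power3_eq_cube)
  with pos' eigen_relation_divide[OF rel, of m]
  have "upper (a' / m) (u' / m) (v' / m) (b' / m) (w' / m) (c' / m) \<in> ?G"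
    unfolding triangle_group_iff[OF assms] by blast
  moreover have "upper (a' / m) (u' / m) (v' / m) (b' / m) (w' / m) (c' / m) $ i $ j \<simeq> A $ i $ j"
    for i j
    using exhaust_3[of i] exhaust_3[of j] ap ap' approx_zero by (auto simp: A upper_def)
  ultimately show "A \<in> shadow ?G" unfolding shadow_def approx_def mem_Collect_eq by blast
qed

text \<open>Solved for \<open>u, v, w\<close>, the relations have finite coefficients, so the
  eigenvalues stay free. Conversely, constant \<open>a, b, c\<close> give a solution with the right
  limits.\<close>

lemma limit_relation_C:
  assumes "\<delta> \<noteq> 0" "\<eta> \<noteq> 0" "1 / \<delta> \<simeq> d" "\<epsilon> / \<eta> \<simeq> r" "1 / \<eta> \<simeq> h"
  shows "limit_relation \<delta> \<epsilon> \<eta> a u v b w c \<longleftrightarrow>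
    u = (b - a) * d \<and> v = (c - a) * h - r * u \<and> w = r * (c - b)"
proof
  have rel: "eigen_relation \<delta> \<epsilon> \<eta> a u v b w c \<longleftrightarrow>
    u = (b - a) * (1 / \<delta>) \<and> v = (c - a) * (1 / \<eta>) - \<epsilon> / \<eta> * u \<and> w = \<epsilon> / \<eta> * (c - b)" for a u v b w c
  proof -
    have "u = (b - a) * (1 / \<delta>) \<longleftrightarrow> b - a = \<delta> * u" "w = \<epsilon> / \<eta> * (c - b) \<longleftrightarrow> \<epsilon> * (c - b) = \<eta> * w"
      using assms(1,2) by (auto simp: eq_divide_eq mult.commute)
    moreover have "(c - a) * (1 / \<eta>) - \<epsilon> / \<eta> * u = (c - a - \<epsilon> * u) / \<eta>"
      by (simp add: diff_divide_distrib)
    then have "v = (c - a) * (1 / \<eta>) - \<epsilon> / \<eta> * u \<longleftrightarrow> c - a = \<eta> * v + \<epsilon> * u"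
      using assms(2) by (auto simp: eq_divide_eq algebra_simps)
    ultimately show ?thesis unfolding eigen_relation_def by blast
  qed
  show "u = (b - a) * d \<and> v = (c - a) * h - r * u \<and> w = r * (c - b)"
    if "limit_relation \<delta> \<epsilon> \<eta> a u v b w c"
  proof -
    from that obtain a' u' v' b' w' c' where *:
      "u' = (b' - a') * (1 / \<delta>)" "v' = (c' - a') * (1 / \<eta>) - \<epsilon> / \<eta> * u'" "w' = \<epsilon> / \<eta> * (c' - b')"
      "a' \<simeq> a" "u' \<simeq> u" "v' \<simeq> v" "b' \<simeq> b" "w' \<simeq> w" "c' \<simeq> c"
      unfolding limit_relation_def rel by blast
    have "u' \<simeq> (b - a) * d" "v' \<simeq> (c - a) * h - r * u" "w' \<simeq> r * (c - b)"
      unfolding *(2,3) by (subst *(1), (intro approx_intros assms *)+)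
    with * show ?thesis by (blast intro: approx_unique)
  qed
  assume *: "u = (b - a) * d \<and> v = (c - a) * h - r * u \<and> w = r * (c - b)"
  let ?a = "hyp_of_real a" and ?b = "hyp_of_real b" and ?c = "hyp_of_real c"
  let ?u = "(?b - ?a) * (1 / \<delta>)"
  have "eigen_relation \<delta> \<epsilon> \<eta> ?a ?u ((?c - ?a) * (1 / \<eta>) - \<epsilon> / \<eta> * ?u) ?b (\<epsilon> / \<eta> * (?c - ?b)) ?c"
    unfolding rel by simp
  moreover have "?u \<simeq> u" "(?c - ?a) * (1 / \<eta>) - \<epsilon> / \<eta> * ?u \<simeq> v" "\<epsilon> / \<eta> * (?c - ?b) \<simeq> w"
    using * assms by (auto intro!: approx_intros simp del: times_divide_eq_right times_divide_eq_left)
  ultimately show "limit_relation \<delta> \<epsilon> \<eta> a u v b w c"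
    unfolding limit_relation_def using approx_hyp_of_real by blast
qed

text \<open>Now \<open>1 / \<eta>\<close> is infinite, so the third relation is solved for
  \<open>c\<close> in place of \<open>v\<close>: \<open>c - a\<close> is \<eta> times a finite
  quantity, and \<open>a, b, v\<close> are free.\<close>

lemma limit_relation_F:
  assumes "\<delta> \<noteq> 0" "\<eta> \<noteq> 0" "1 / \<delta> \<simeq> d" "\<epsilon> / \<eta> \<simeq> r" "\<eta> \<simeq> 0"
  shows "limit_relation \<delta> \<epsilon> \<eta> a u v b w c \<longleftrightarrow> c = a \<and> u = (b - a) * d \<and> w = r * (a - b)"
proof
  have rel: "eigen_relation \<delta> \<epsilon> \<eta> a u v b w c \<longleftrightarrow>
    u = (b - a) * (1 / \<delta>) \<and> c = a + \<eta> * (v + \<epsilon> / \<eta> * u) \<and> w = \<epsilon> / \<eta> * (c - b)" for a u v b w c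
  proof -
    have "u = (b - a) * (1 / \<delta>) \<longleftrightarrow> b - a = \<delta> * u" "w = \<epsilon> / \<eta> * (c - b) \<longleftrightarrow> \<epsilon> * (c - b) = \<eta> * w"
      using assms(1,2) by (auto simp: eq_divide_eq mult.commute)
    moreover have "a + \<eta> * (v + \<epsilon> / \<eta> * u) = a + (\<eta> * v + \<epsilon> * u)"
      using assms(2) by (simp add: distrib_left)
    then have "c = a + \<eta> * (v + \<epsilon> / \<eta> * u) \<longleftrightarrow> c - a = \<eta> * v + \<epsilon> * u"
      by (auto simp: algebra_simps)
    ultimately show ?thesis unfolding eigen_relation_def by blast
  qed
  show "c = a \<and> u = (b - a) * d \<and> w = r * (a - b)" if "limit_relation \<delta> \<epsilon> \<eta> a u v b w c"
  proof -
    from that obtain a' u' v' b' w' c' where *: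
      "u' = (b' - a') * (1 / \<delta>)" "c' = a' + \<eta> * (v' + \<epsilon> / \<eta> * u')" "w' = \<epsilon> / \<eta> * (c' - b')"
      "a' \<simeq> a" "u' \<simeq> u" "v' \<simeq> v" "b' \<simeq> b" "w' \<simeq> w" "c' \<simeq> c"
      unfolding limit_relation_def rel by blast
    have "u' \<simeq> (b - a) * d" "w' \<simeq> r * (c - b)" "c' \<simeq> a + 0 * (v + r * u)"
      by (subst *(1), (intro approx_intros assms *)) (subst *(3), (intro approx_intros assms *),
        subst *(2), (intro approx_intros assms *))
    then show ?thesis using *(4-9)[THEN approx_unique] by simp
  qed
  assume *: "c = a \<and> u = (b - a) * d \<and> w = r * (a - b)"
  let ?a = "hyp_of_real a" and ?b = "hyp_of_real b" and ?v = "hyp_of_real v"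
  let ?u = "(?b - ?a) * (1 / \<delta>)"
  let ?c = "?a + \<eta> * (?v + \<epsilon> / \<eta> * ?u)"
  have "eigen_relation \<delta> \<epsilon> \<eta> ?a ?u ?v ?b (\<epsilon> / \<eta> * (?c - ?b)) ?c"
    unfolding rel by simp
  moreover have "?u \<simeq> (b - a) * d" "?c \<simeq> a + 0 * (v + r * ((b - a) * d))"
    "\<epsilon> / \<eta> * (?c - ?b) \<simeq> r * (a + 0 * (v + r * ((b - a) * d)) - b)"
    by (intro approx_intros assms)+
  then have "?u \<simeq> u" "?c \<simeq> c" "\<epsilon> / \<eta> * (?c - ?b) \<simeq> w"
    using * by (simp_all del: times_divide_eq_right times_divide_eq_left)
  ultimately show "limit_relation \<delta> \<epsilon> \<eta> a u v b w c"
    unfolding limit_relation_def using approx_hyp_of_real by blast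
qed

text \<open>With \<open>\<epsilon> / \<eta>\<close> infinite the free unknowns are
  \<open>b, v, w\<close>. In terms of \<open>v\<close> and \<open>w\<close>, the differences of the
  eigenvalues and \<open>u\<close> have infinitesimal coefficients, so the eigenvalues merge and
  \<open>u\<close> vanishes.\<close>

lemma limit_relation_N3:
  assumes "\<delta> \<noteq> 0" "\<eta> \<noteq> 0" "\<epsilon> \<noteq> 0" "\<delta> \<noteq> \<epsilon>"
    and ap: "1 / (\<epsilon> / \<eta>) \<simeq> 0" "1 / (\<epsilon> * \<delta> / \<eta>) \<simeq> 0" "\<eta> \<simeq> 0" "\<eta> / \<delta> \<simeq> 0"
      "1 / (1 - \<epsilon> / \<delta>) \<simeq> k"
  shows "limit_relation \<delta> \<epsilon> \<eta> a u v b w c \<longleftrightarrow> b = a \<and> c = a \<and> u = 0"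
proof
  let ?r = "1 / (\<epsilon> / \<eta>)" and ?s = "1 / (\<epsilon> * \<delta> / \<eta>)" and ?k = "1 / (1 - \<epsilon> / \<delta>)"
  have rel: "eigen_relation \<delta> \<epsilon> \<eta> a u v b w c \<longleftrightarrow>
    a = b - (\<eta> * v - ?r * w) * ?k \<and> c = b + ?r * w \<and> u = (\<eta> / \<delta> * v - ?s * w) * ?k" for a u v b w c
  proof
    assume "eigen_relation \<delta> \<epsilon> \<eta> a u v b w c"
    then have e: "b - a = \<delta> * u" "\<epsilon> * (c - b) = \<eta> * w" "c - a = \<eta> * v + \<epsilon> * u"
      by (simp_all add: eigen_relation_def)
    have c: "c = b + ?r * w" using e(2) assms(3) by (simp add: field_simps)
    \<comment> \<open>Write \<open>c - a\<close> as \<open>(c - b) + (b - a)\<close> and insert the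
      relations.\<close>
    have "u * (\<delta> - \<epsilon>) = \<eta> * v - ?r * w" using e(1,3) unfolding c by (simp add: algebra_simps)
    then have u: "u = (\<eta> * v - ?r * w) / (\<delta> - \<epsilon>)" using assms(4) by (simp add: eq_divide_eq)
    have "u = (\<eta> / \<delta> * v - ?s * w) * ?k"
      unfolding u using assms(1-4) by (simp add: divide_simps)
    moreover have "\<delta> * u = (\<eta> * v - ?r * w) * ?k"
      unfolding u using assms(1-4) by (simp add: divide_simps)
    then have "a = b - (\<eta> * v - ?r * w) * ?k" using e(1) by (simp add: algebra_simps)
    ultimately show "a = b - (\<eta> * v - ?r * w) * ?k \<and> c = b + ?r * w \<and> u = (\<eta> / \<delta> * v - ?s * w) * ?k"
      using c by blast
  next
    assume "a = b - (\<eta> * v - ?r * w) * ?k \<and> c = b + ?r * w \<and> u = (\<eta> / \<delta> * v - ?s * w) * ?k"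
    then have *: "a = b - (\<eta> * v - ?r * w) * ?k" "c = b + ?r * w" "u = (\<eta> / \<delta> * v - ?s * w) * ?k"
      by blast+
    have "\<delta> * u = (\<eta> * v - ?r * w) * ?k"
      unfolding *(3) using assms(1-4) by (simp add: divide_simps)
    then have 1: "b - a = \<delta> * u" using *(1) by (simp add: algebra_simps)
    have 2: "\<epsilon> * (c - b) = \<eta> * w" using *(2) assms(2,3) by simp
    have "u * (\<delta> - \<epsilon>) = \<eta> * v - ?r * w"
      unfolding *(3) using assms(1-4) by (simp add: divide_simps)
    then have "c - a = \<eta> * v + \<epsilon> * u" using 1 *(2) by (simp add: algebra_simps)
    with 1 2 show "eigen_relation \<delta> \<epsilon> \<eta> a u v b w c" by (simp add: eigen_relation_def)
  qed
  show "b = a \<and> c = a \<and> u = 0" if "limit_relation \<delta> \<epsilon> \<eta> a u v b w c"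
  proof -
    from that obtain a' u' v' b' w' c' where *:
      "a' = b' - (\<eta> * v' - ?r * w') * ?k" "c' = b' + ?r * w'" "u' = (\<eta> / \<delta> * v' - ?s * w') * ?k"
      "a' \<simeq> a" "u' \<simeq> u" "v' \<simeq> v" "b' \<simeq> b" "w' \<simeq> w" "c' \<simeq> c"
      unfolding limit_relation_def rel by blast
    have "a' \<simeq> b - (0 * v - 0 * w) * k"
      by (subst *(1)) (intro approx_intros ap *)
    moreover have "c' \<simeq> b + 0 * w"
      by (subst *(2)) (intro approx_intros ap *)
    moreover have "u' \<simeq> (0 * v - 0 * w) * k"
      by (subst *(3)) (intro approx_intros ap *)
    ultimately show ?thesis using *(4,5,9)[THEN approx_unique] by simp
  qed
  assume *: "b = a \<and> c = a \<and> u = 0"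
  let ?b = "hyp_of_real a" and ?v = "hyp_of_real v" and ?w = "hyp_of_real w"
  let ?a = "?b - (\<eta> * ?v - ?r * ?w) * ?k" and ?c = "?b + ?r * ?w" and ?u = "(\<eta> / \<delta> * ?v - ?s * ?w) * ?k"
  have "eigen_relation \<delta> \<epsilon> \<eta> ?a ?u ?v ?b ?w ?c"
    unfolding rel by simp
  moreover have "?a \<simeq> a - (0 * v - 0 * w) * k" "?c \<simeq> a + 0 * w" "?u \<simeq> (0 * v - 0 * w) * k"
    by (intro approx_intros ap)+
  then have "?a \<simeq> a" "?c \<simeq> a" "?u \<simeq> 0" by simp_all
  ultimately show "limit_relation \<delta> \<epsilon> \<eta> a u v b w c"
    unfolding limit_relation_def using * approx_hyp_of_real by blast
qed

text \<open>The free unknowns are \<open>a, u, v\<close>. Expressing \<open>c - b\<close> through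
  \<open>u\<close> and \<open>v\<close> in the second relation leaves an infinitesimal multiple of
  \<open>v\<close> and a finite multiple of \<open>u\<close>, governed by
  \<open>\<epsilon> * \<delta> / \<eta>\<close>.\<close>

lemma limit_relation_N12:
  assumes "\<delta> \<noteq> 0" "\<eta> \<noteq> 0"
    and ap: "\<delta> \<simeq> 0" "\<epsilon> \<simeq> 0" "\<eta> \<simeq> 0" "\<epsilon> * \<delta> / \<eta> \<simeq> s" "1 - \<epsilon> / \<delta> \<simeq> k"
  shows "limit_relation \<delta> \<epsilon> \<eta> a u v b w c \<longleftrightarrow> b = a \<and> c = a \<and> w = - (s * k * u)"
proof
  let ?s = "\<epsilon> * \<delta> / \<eta>" and ?k = "1 - \<epsilon> / \<delta>"
  have rel: "eigen_relation \<delta> \<epsilon> \<eta> a u v b w c \<longleftrightarrow>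
    b = a + \<delta> * u \<and> c = a + (\<eta> * v + \<epsilon> * u) \<and> w = \<epsilon> * v - ?s * ?k * u" for a u v b w c
  proof -
    have "\<eta> * (\<epsilon> * v - ?s * ?k * u) = \<epsilon> * (\<eta> * v + \<epsilon> * u - \<delta> * u)"
      using assms(1,2) by (simp add: divide_simps) (simp add: algebra_simps)
    then have "w = \<epsilon> * v - ?s * ?k * u \<longleftrightarrow> \<epsilon> * (\<eta> * v + \<epsilon> * u - \<delta> * u) = \<eta> * w"
      using assms(2) by (metis mult_cancel_left)
    then show ?thesis unfolding eigen_relation_def by (auto simp: algebra_simps)
  qed
  show "b = a \<and> c = a \<and> w = - (s * k * u)" if "limit_relation \<delta> \<epsilon> \<eta> a u v b w c"
  proof -
    from that obtain a' u' v' b' w' c' where *: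
      "b' = a' + \<delta> * u'" "c' = a' + (\<eta> * v' + \<epsilon> * u')" "w' = \<epsilon> * v' - ?s * ?k * u'"
      "a' \<simeq> a" "u' \<simeq> u" "v' \<simeq> v" "b' \<simeq> b" "w' \<simeq> w" "c' \<simeq> c"
      unfolding limit_relation_def rel by blast
    have "b' \<simeq> a + 0 * u"
      by (subst *(1)) (intro approx_intros ap *)
    moreover have "c' \<simeq> a + (0 * v + 0 * u)"
      by (subst *(2)) (intro approx_intros ap *)
    moreover have "w' \<simeq> 0 * v - s * k * u"
      by (subst *(3)) (intro approx_intros ap *)
    ultimately show ?thesis using *(7-9)[THEN approx_unique] by simp
  qed
  assume *: "b = a \<and> c = a \<and> w = - (s * k * u)"
  let ?a = "hyp_of_real a" and ?u = "hyp_of_real u" and ?v = "hyp_of_real v"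
  let ?b = "?a + \<delta> * ?u" and ?c = "?a + (\<eta> * ?v + \<epsilon> * ?u)" and ?w = "\<epsilon> * ?v - ?s * ?k * ?u"
  have "eigen_relation \<delta> \<epsilon> \<eta> ?a ?u ?v ?b ?w ?c"
    unfolding rel by simp
  moreover have "?b \<simeq> a + 0 * u" "?c \<simeq> a + (0 * v + 0 * u)" "?w \<simeq> 0 * v - s * k * u"
    by (intro approx_intros ap)+
  then have "?b \<simeq> b" "?c \<simeq> c" "?w \<simeq> w" using * by simp_all
  ultimately show "limit_relation \<delta> \<epsilon> \<eta> a u v b w c"
    unfolding limit_relation_def using approx_hyp_of_real by blast
qed

section \<open>Conjugacy of the shadows to the groups in \<open>\<Q>\<close>\<close>

abbreviation triangle_shadow :: "hyperreal \<Rightarrow> hyperreal \<Rightarrow> hyperreal \<Rightarrow> (real ^ 3 ^ 3) set" where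
  "triangle_shadow \<delta> \<epsilon> \<eta> \<equiv>
     shadow (triangle_group (vector [1, 0, 0]) (vector [1, \<delta>, 0]) (vector [1, \<epsilon>, \<eta>]))"

lemma group_upper:
  "group_C = {upper a 0 0 b 0 (1 / (a * b)) | a b. a > 0 \<and> b > 0}"
  "group_F = {upper a t 0 a 0 (1 / a\<^sup>2) | a t. a > 0}"
  "group_N1 = {upper 1 s t 1 s 1 | s t. True}"
  "group_N2 = {upper 1 s t 1 0 1 | s t. True}"
  "group_N3 = {upper 1 0 t 1 s 1 | s t. True}"
  by (simp_all add: group_C_def group_F_def group_N1_def group_N2_def group_N3_def upper_def)

text \<open>Where the three eigenvalues share a limit, determinant 1 forces it to be 1, so the
  shadow is unipotent.\<close>

lemma cube_eq_one:
  fixes a :: real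
  assumes "a > 0" "a * a * a = 1"
  shows "a = 1"
  using assms power_inject_base[of a 2 1] by (simp add: power3_eq_cube numeral_3_eq_3 mult.assoc)

text \<open>The rescaled vertices \<open>p\<close>, \<open>q / \<delta>\<close>,
  \<open>x / \<eta>\<close> have finite coordinates and their standard parts remain independent, so
  the limit matrices are diagonal in this basis.\<close>

lemma shadow_conjugate_C:
  assumes "\<not> infinitesimal \<delta>" "\<not> infinitesimal \<eta>" "finite_hyp (\<epsilon> / \<eta>)"
  shows "conjugate_SL3 (triangle_shadow \<delta> \<epsilon> \<eta>) group_C"
proof -
  have nz: "\<delta> \<noteq> 0" "\<eta> \<noteq> 0" using assms by (auto simp: infinitesimal_iff_approx approx_zero)
  obtain d r h where lim: "1 / \<delta> \<simeq> d" "\<epsilon> / \<eta> \<simeq> r" "1 / \<eta> \<simeq> h"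
    using assms finite_hyp_inverse unfolding finite_hyp_iff_approx by blast
  \<comment> \<open>the columns are eigenvectors of the limit matrices\<close>
  let ?P = "upper 1 d h 1 r 1"
  show ?thesis
    unfolding shadow_triangle_group[OF nz] limit_relation_C[OF nz lim] group_upper
  proof (rule conjugate_SL3I[of ?P])
    fix A assume "A \<in> {upper a 0 0 b 0 (1 / (a * b)) | a b :: real. a > 0 \<and> b > 0}"
    then obtain a b where A: "A = upper a 0 0 b 0 (1 / (a * b))" "a > 0" "b > 0" by blast
    define c where "c = 1 / (a * b)"
    have "upper a ((b - a) * d) ((c - a) * h - r * ((b - a) * d)) b (r * (c - b)) c ** ?P = ?P ** A"
      unfolding A c_def[symmetric] by (simp add: upper_mult algebra_simps)
    moreover have "c > 0" "a * b * c = 1" using A by (simp_all add: c_def)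
    ultimately show "\<exists>B\<in>{upper a u v b w c |a u v b w c. (u = (b - a) * d \<and> v = (c - a) * h - r * u \<and>
        w = r * (c - b)) \<and> 0 < a \<and> 0 < b \<and> 0 < c \<and> a * b * c = 1}. B ** ?P = ?P ** A"
      using A by blast
  next
    fix B assume "B \<in> {upper a u v b w c |a u v b w c. (u = (b - a) * d \<and> v = (c - a) * h - r * u \<and>
        w = r * (c - b)) \<and> 0 < a \<and> 0 < b \<and> 0 < c \<and> a * b * c = 1}"
    then obtain a b c where B: "B = upper a ((b - a) * d) ((c - a) * h - r * ((b - a) * d)) b (r * (c - b)) c"
      "a > 0" "b > 0" "a * b * c = 1" by blast
    then have "c = 1 / (a * b)" by (simp add: field_simps)
    moreover have "B ** ?P = ?P ** upper a 0 0 b 0 c"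
      unfolding B by (simp add: upper_mult algebra_simps)
    ultimately show "\<exists>A\<in>{upper a 0 0 b 0 (1 / (a * b)) | a b. a > 0 \<and> b > 0}. B ** ?P = ?P ** A"
      using B by blast
  qed (simp add: det_upper)
qed

text \<open>Here \<eta> and \<epsilon> are infinitesimal, so \<open>x\<close> merges with
  \<open>p\<close>; their eigenvalues coincide in the limit, which creates a Jordan block.\<close>

lemma shadow_conjugate_F:
  assumes "\<not> infinitesimal \<delta>" "infinitesimal \<eta>" "\<eta> \<noteq> 0" "finite_hyp (\<epsilon> / \<eta>)"
  shows "conjugate_SL3 (triangle_shadow \<delta> \<epsilon> \<eta>) group_F"
proof -
  have nz: "\<delta> \<noteq> 0" "\<eta> \<noteq> 0" using assms by (auto simp: infinitesimal_iff_approx approx_zero)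
  obtain d r where lim: "1 / \<delta> \<simeq> d" "\<epsilon> / \<eta> \<simeq> r"
    using assms finite_hyp_inverse unfolding finite_hyp_iff_approx by blast
  have \<eta>: "\<eta> \<simeq> 0" using assms(2) by (simp add: infinitesimal_iff_approx)
  \<comment> \<open>The first column is \<open>p\<close>; the third is the negated limit of
    \<open>q / \<delta>\<close>, with eigenvalue \<open>b\<close>; the second is sent to
    \<open>a\<close> times itself plus \<open>u * r + v\<close> times the first. The sign makes the
    determinant 1.\<close>
  let ?P = "vector [vector [1, 0, - d], vector [0, r, - 1], vector [0, 1, 0]] :: real ^ 3 ^ 3"
  have conj: "upper a u v b w a ** ?P = ?P ** upper a (u * r + v) 0 a 0 b"
    if "u = (b - a) * d" "w = r * (a - b)" for a u v b w
    using that by (simp add: upper_def matrix_matrix_mult_def vec_eq_iff forall_3 sum_3 algebra_simps)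
  show ?thesis
    unfolding shadow_triangle_group[OF nz] limit_relation_F[OF nz lim \<eta>] group_upper
  proof (rule conjugate_SL3I[of ?P])
    fix A assume "A \<in> {upper a t 0 a 0 (1 / a\<^sup>2) | a t :: real. a > 0}"
    then obtain a t where A: "A = upper a t 0 a 0 (1 / a\<^sup>2)" "a > 0" by blast
    define b where "b = 1 / a\<^sup>2"
    have "b > 0" "a * b * a = 1" using A by (simp_all add: b_def power2_eq_square)
    \<comment> \<open>The entry \<open>v\<close> is chosen to make \<open>u * r + v\<close> equal to
      \<open>t\<close>.\<close>
    moreover have "upper a ((b - a) * d) (t - (b - a) * d * r) b (r * (a - b)) a ** ?P = ?P ** A"
      unfolding A b_def[symmetric] by (subst conj) simp_all
    ultimately show "\<exists>B\<in>{upper a u v b w c |a u v b w c. (c = a \<and> u = (b - a) * d \<and> w = r * (a - b)) \<and>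
        0 < a \<and> 0 < b \<and> 0 < c \<and> a * b * c = 1}. B ** ?P = ?P ** A"
      using A by blast
  next
    fix B assume "B \<in> {upper a u v b w c |a u v b w c. (c = a \<and> u = (b - a) * d \<and> w = r * (a - b)) \<and>
        0 < a \<and> 0 < b \<and> 0 < c \<and> a * b * c = 1}"
    then obtain a u v b w where B: "B = upper a u v b w a" "u = (b - a) * d" "w = r * (a - b)"
      "a > 0" "a * b * a = 1" by blast
    have "b = 1 / a\<^sup>2" using B(4,5) by (simp add: field_simps power2_eq_square)
    with conj[OF B(2,3), of v] B(1,4)
    show "\<exists>A\<in>{upper a t 0 a 0 (1 / a\<^sup>2) | a t. a > 0}. B ** ?P = ?P ** A"
      by blast
  qed (simp add: det_3)
qed

lemma conjugate_SL3_refl: "conjugate_SL3 G G"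
  by (rule conjugate_SL3I[of "mat 1"]) auto

lemma shadow_conjugate_N3:
  assumes nz: "\<delta> \<noteq> 0" "\<eta> \<noteq> 0" "\<epsilon> \<noteq> 0" "\<delta> \<noteq> \<epsilon>"
    and ap: "1 / (\<epsilon> / \<eta>) \<simeq> 0" "1 / (\<epsilon> * \<delta> / \<eta>) \<simeq> 0" "\<eta> \<simeq> 0" "\<eta> / \<delta> \<simeq> 0"
      "1 / (1 - \<epsilon> / \<delta>) \<simeq> k"
  shows "conjugate_SL3 (triangle_shadow \<delta> \<epsilon> \<eta>) group_N3"
proof -
  have "triangle_shadow \<delta> \<epsilon> \<eta> = group_N3"
    unfolding shadow_triangle_group[OF nz(1,2)] limit_relation_N3[OF nz ap] group_upper
    by (auto dest: cube_eq_one)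
  then show ?thesis by (simp add: conjugate_SL3_refl)
qed

text \<open>The limit matrices are unipotent with \<open>w\<close> proportional to \<open>u\<close>;
  as \<open>k\<close> is nonzero, the factor vanishes exactly when \<open>s = 0\<close>.\<close>

lemma shadow_conjugate_N12:
  assumes nz: "\<delta> \<noteq> 0" "\<eta> \<noteq> 0"
    and ap: "\<delta> \<simeq> 0" "\<epsilon> \<simeq> 0" "\<eta> \<simeq> 0" "\<epsilon> * \<delta> / \<eta> \<simeq> s" "1 - \<epsilon> / \<delta> \<simeq> k"
    and k: "k \<noteq> 0"
  shows "conjugate_SL3 (triangle_shadow \<delta> \<epsilon> \<eta>) (if s = 0 then group_N2 else group_N1)"
proof (cases "s = 0")
  case True
  have "triangle_shadow \<delta> \<epsilon> \<eta> = group_N2"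
    unfolding shadow_triangle_group[OF nz] limit_relation_N12[OF nz ap] group_upper True
    by (auto dest: cube_eq_one)
  then show ?thesis by (simp add: conjugate_SL3_refl True)
next
  case False
  \<comment> \<open>Conjugation by the diagonal matrix (1, \<open>m\<close>, \<open>1 / m\<close>)
    turns \<open>u\<close> into \<open>m * u\<close> and \<open>w\<close> into
    \<open>w / m\<^sup>2\<close>. These agree when \<open>w = m\<^sup>3 * u\<close>, so
    \<open>m\<close> is the real cube root of the proportionality factor, whatever its sign.\<close>
  define m where "m = root 3 (- (s * k))"
  have m: "m \<noteq> 0" using False k by (simp add: m_def)
  have m3: "m * m * m = - (s * k)"
    by (simp add: m_def odd_real_root_pow flip: power3_eq_cube)
  have *: "triangle_shadow \<delta> \<epsilon> \<eta> = {upper 1 u v 1 (m * m * m * u) 1 | u v. True}"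
    unfolding shadow_triangle_group[OF nz] limit_relation_N12[OF nz ap] m3
    by (auto dest: cube_eq_one)
  let ?P = "upper 1 0 0 m 0 (1 / m)"
  have conj: "upper 1 u v 1 (m * m * m * u) 1 ** ?P = ?P ** upper 1 (m * u) (v / m) 1 (m * u) 1" for u v
    using m by (simp add: upper_mult)
  have "conjugate_SL3 (triangle_shadow \<delta> \<epsilon> \<eta>) group_N1"
    unfolding * group_upper
  proof (rule conjugate_SL3I[of ?P])
    fix A assume "A \<in> {upper 1 s t 1 s 1 | s t :: real. True}"
    then obtain s t where A: "A = upper 1 s t 1 s 1" by blast
    have "upper 1 (s / m) (t * m) 1 (m * m * m * (s / m)) 1 ** ?P = ?P ** A"
      unfolding A by (subst conj) (use m in simp)
    then show "\<exists>B\<in>{upper 1 u v 1 (m * m * m * u) 1 | u v. True}. B ** ?P = ?P ** A" by blast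
  next
    fix B assume "B \<in> {upper 1 u v 1 (m * m * m * u) 1 | u v :: real. True}"
    then show "\<exists>A\<in>{upper 1 s t 1 s 1 | s t. True}. B ** ?P = ?P ** A" using conj by blast
  qed (use m in \<open>simp add: det_upper\<close>)
  with False show ?thesis by simp
qed

section \<open>Reading the table off the regimes\<close>

theorem theorem3:
  fixes p q x y :: "hyperreal ^ 3" and \<alpha> \<delta> \<epsilon> \<eta> :: hyperreal
  assumes "labelled_triangle p q x y"
    and "p = vector [1, 0, 0]" and "q = vector [1, \<delta>, 0]"
    and "y = vector [1, \<epsilon>, 0]" and "x = vector [1, \<epsilon>, \<eta>]"
    and "\<delta> \<noteq> 0" and "\<eta> \<noteq> 0" and "\<bar>\<eta>\<bar> \<le> \<bar>\<delta>\<bar>" and "\<bar>\<epsilon>\<bar> \<le> \<bar>\<delta>\<bar>"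
    and "\<alpha> = \<epsilon> * \<delta> / \<eta>"
  shows "(\<exists>H\<in>\<Q>. conjugate_SL3 (shadow (triangle_group p q x)) H) \<and>
    (num_infinitesimal_angles p q x = 0 \<and> num_infinitesimal_sides p q x = 0 \<and> appreciable \<alpha>
       \<longrightarrow> conjugate_SL3 (shadow (triangle_group p q x)) group_C) \<and>
    (num_infinitesimal_angles p q x = 1 \<and> num_infinitesimal_sides p q x = 1 \<and> finite_hyp \<alpha>
       \<longrightarrow> conjugate_SL3 (shadow (triangle_group p q x)) group_F) \<and>
    (num_infinitesimal_angles p q x = 2 \<and> num_infinitesimal_sides p q x = 3 \<and> appreciable \<alpha>
       \<longrightarrow> conjugate_SL3 (shadow (triangle_group p q x)) group_N1) \<and>
    (num_infinitesimal_sides p q x = 3 \<and> infinitesimal \<alpha>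
       \<longrightarrow> conjugate_SL3 (shadow (triangle_group p q x)) group_N2) \<and>
    (num_infinitesimal_angles p q x = 2 \<and> infinite_hyp \<alpha>
       \<longrightarrow> conjugate_SL3 (shadow (triangle_group p q x)) group_N3)"
proof -
  note pqx = assms(2,3,5) and nz = assms(6,7) and \<alpha> = assms(10)
  let ?G = "triangle_shadow \<delta> \<epsilon> \<eta>"
  have G: "shadow (triangle_group p q x) = ?G" by (simp add: pqx)

  have near: "2 * (\<epsilon> / \<delta>) + \<epsilon>\<^sup>2 \<le> 1"
    using assms(1) nz(1) unfolding labelled_triangle_def assms(2-5)
    by (blast intro: nearer_vertex_imp)
  have "\<bar>\<epsilon> / \<delta>\<bar> \<le> 1" using nz assms(9) by (simp add: abs_divide)
  then have ratio: "- 1 \<le> \<epsilon> / \<delta>" "\<epsilon> / \<delta> \<le> 1 / 2"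
    using near zero_le_power2[of \<epsilon>] by linarith+
  \<comment> \<open>\<open>near\<close> and \<open>\<epsilon> / \<delta> \<ge> - 1\<close> give the
    bound 3, rounded up to a square.\<close>
  then have "\<epsilon>\<^sup>2 \<le> 2\<^sup>2" using near by simp
  then have "\<bar>\<epsilon>\<bar> \<le> of_nat 2" unfolding abs_le_square_iff[symmetric] by simp
  then have fin_\<epsilon>: "finite_hyp \<epsilon>" by (rule finite_hypI)
  \<comment> \<open>By the choice of the nearer vertex, \<kappa> lies between 1/2 and 2, so its
    standard part is nonzero.\<close>
  define \<kappa> where "\<kappa> = 1 - \<epsilon> / \<delta>"
  have \<kappa>: "1 / 2 \<le> \<kappa>" "\<bar>\<kappa>\<bar> \<le> of_nat 2" using ratio by (simp_all add: \<kappa>_def)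
  then have "\<kappa> > 0" by (intro less_le_trans[OF _ \<kappa>(1)]) simp
  with \<kappa> have "\<bar>1 / \<kappa>\<bar> \<le> of_nat 2" by (simp add: abs_divide divide_le_eq)
  with \<kappa>(2) have "finite_hyp \<kappa>" "finite_hyp (1 / \<kappa>)" by (blast intro: finite_hypI)+
  then obtain k k' where k: "\<kappa> \<simeq> k" "1 / \<kappa> \<simeq> k'" by (auto simp: finite_hyp_iff_approx)
  have "k * k' = 1"
    using approx_mult[OF k] approx_one \<open>\<kappa> > 0\<close> by (auto dest: approx_unique)
  then have k0: "k \<noteq> 0" by auto
  have \<delta>\<epsilon>: "\<delta> \<noteq> \<epsilon>" using \<open>\<kappa> > 0\<close> nz by (auto simp: \<kappa>_def)
  note inf = infinitesimal_iff_approx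

  have C: "conjugate_SL3 ?G group_C"
    if "\<not> infinitesimal \<delta>" "finite_hyp (\<epsilon> / \<eta>)" "\<not> infinitesimal \<eta>"
    using that by (intro shadow_conjugate_C)
  have F: "conjugate_SL3 ?G group_F"
    if "\<not> infinitesimal \<delta>" "finite_hyp (\<epsilon> / \<eta>)" "infinitesimal \<eta>"
    using that nz by (intro shadow_conjugate_F)
  \<comment> \<open>The second conjunct separates the rows:
    \<open>\<epsilon> / \<eta> = \<alpha> * (1 / \<delta>)\<close> with \<open>1 / \<delta>\<close>
    finite, so a finite \<alpha> rules this case out.\<close>
  have A3: "conjugate_SL3 ?G group_N3 \<and> infinite_hyp \<alpha>"
    if "\<not> infinitesimal \<delta>" "\<not> finite_hyp (\<epsilon> / \<eta>)"
  proof
    have fin: "finite_hyp (1 / \<delta>)" using that(1) by (rule finite_hyp_inverse)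
    have \<epsilon>0: "\<epsilon> \<noteq> 0" using that(2) approx_zero by (auto simp: finite_hyp_iff_approx)
    have r: "1 / (\<epsilon> / \<eta>) \<simeq> 0"
      using that(2) by (intro infinitesimal_inverse) (simp add: finite_hyp_def)
    \<comment> \<open>These products are \<eta> and \<open>1 / \<alpha>\<close>.\<close>
    have "1 / (\<epsilon> / \<eta>) * \<epsilon> \<simeq> 0" "1 / (\<epsilon> / \<eta>) * (1 / \<delta>) \<simeq> 0"
      using r fin fin_\<epsilon> unfolding inf[symmetric] by (blast intro: infinitesimal_mult)+
    then have \<eta>: "\<eta> \<simeq> 0" and a: "1 / (\<epsilon> * \<delta> / \<eta>) \<simeq> 0"
      using \<epsilon>0 by simp_all
    have "\<eta> * (1 / \<delta>) \<simeq> 0"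
      using \<eta> fin unfolding inf[symmetric] by (rule infinitesimal_mult)
    then have "\<eta> / \<delta> \<simeq> 0" by simp
    with nz \<epsilon>0 \<delta>\<epsilon> r a \<eta> k(2) show "conjugate_SL3 ?G group_N3"
      unfolding \<kappa>_def by (intro shadow_conjugate_N3)
    show "infinite_hyp \<alpha>"
    proof (rule ccontr)
      assume "\<not> infinite_hyp \<alpha>"
      then have "finite_hyp (\<alpha> * (1 / \<delta>))"
        using fin by (intro finite_hyp_mult) (simp_all add: finite_hyp_def)
      with that(2) nz show False by (simp add: \<alpha>)
    qed
  qed
  have small: "infinitesimal \<epsilon>" "infinitesimal \<eta>" if "infinitesimal \<delta>"
    using that assms(8,9) by (auto intro: infinitesimal_le)
  have N12: "conjugate_SL3 ?G (if infinitesimal \<alpha> then group_N2 else group_N1)"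
    if small_\<delta>: "infinitesimal \<delta>" and fin_\<alpha>: "finite_hyp \<alpha>"
  proof -
    obtain s where s: "\<alpha> \<simeq> s" using fin_\<alpha> by (auto simp: finite_hyp_iff_approx)
    then have "infinitesimal \<alpha> \<longleftrightarrow> s = 0"
      by (auto simp: inf dest: approx_unique)
    with shadow_conjugate_N12[OF nz _ _ _ s[unfolded \<alpha>] k(1)[unfolded \<kappa>_def] k0] small_\<delta> small[OF small_\<delta>]
    show ?thesis by (simp add: inf)
  qed
  have N3: "conjugate_SL3 ?G group_N3" if "infinitesimal \<delta>" "infinite_hyp \<alpha>"
  proof -
    have "of_nat 0 < \<bar>\<alpha>\<bar>" using that(2) unfolding infinite_hyp_def by blast
    then have \<epsilon>0: "\<epsilon> \<noteq> 0" by (auto simp: \<alpha>)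
    have ap: "\<delta> \<simeq> 0" "\<epsilon> \<simeq> 0" "\<eta> \<simeq> 0" using that small by (simp_all add: inf)
    have a: "1 / (\<epsilon> * \<delta> / \<eta>) \<simeq> 0" using infinitesimal_inverse[OF that(2)] by (simp add: \<alpha>)
    \<comment> \<open>They equal \<delta> and \<epsilon> times \<open>1 / \<alpha>\<close>.\<close>
    have "1 / (\<epsilon> / \<eta>) \<simeq> 0" "\<eta> / \<delta> \<simeq> 0"
      using approx_mult[OF ap(1) a] approx_mult[OF ap(2) a] nz \<epsilon>0 by simp_all
    with nz \<epsilon>0 \<delta>\<epsilon> a ap(3) k(2) show ?thesis
      unfolding \<kappa>_def by (intro shadow_conjugate_N3)
  qed

  have pq: "infinitesimal (hdist p q) \<longleftrightarrow> infinitesimal \<delta>"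
    unfolding pqx by (rule infinitesimal_side_pq)
  have xp: "infinitesimal (hdist x p)" if "infinitesimal \<epsilon>" "infinitesimal \<eta>"
    unfolding pqx using that by (rule infinitesimal_side_xp)
  have far: "\<not> infinitesimal (hdist x p)" "\<not> infinitesimal (hdist q x)"
    if "\<not> infinitesimal \<eta>" "finite_hyp (\<epsilon> / \<eta>)"
    unfolding pqx using that by (simp_all add: not_infinitesimal_side_xp not_infinitesimal_side_qx)
  have \<epsilon>\<eta>: "infinitesimal \<epsilon>" if "infinitesimal \<eta>" "finite_hyp (\<epsilon> / \<eta>)"
    using infinitesimal_mult[OF that] nz by simp
  \<comment> \<open>Three infinitesimal sides include \<open>pq\<close>. An infinitesimal \<delta>
    makes both \<open>pq\<close> and \<open>xp\<close> infinitesimal, which excludes the counts 0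
    and 1.\<close>
  have sides: "num_infinitesimal_sides p q x = 3 \<Longrightarrow> infinitesimal \<delta>"
    "num_infinitesimal_sides p q x = 1 \<Longrightarrow> \<not> infinitesimal \<delta>"
    "num_infinitesimal_sides p q x = 0 \<Longrightarrow> \<not> infinitesimal \<delta>"
    unfolding num_infinitesimal_sides_def using xp[OF small] pq by (auto split: if_splits)

  \<comment> \<open>As \<open>\<alpha> = \<epsilon> / \<eta> * \<delta>\<close>, here \<delta> is
    infinite; then the angles at \<open>p\<close> and \<open>x\<close> are not infinitesimal, and at
    most one angle is left.\<close>
  have angles: "num_infinitesimal_angles p q x \<noteq> 2"
    if "infinite_hyp \<alpha>" "finite_hyp (\<epsilon> / \<eta>)"
  proof -
    have "infinite_hyp \<delta>"
    proof (rule ccontr)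
      assume "\<not> infinite_hyp \<delta>"
      then have "finite_hyp (\<epsilon> / \<eta> * \<delta>)"
        using that(2) by (intro finite_hyp_mult) (simp_all add: finite_hyp_def)
      with that(1) show False by (simp add: \<alpha> finite_hyp_def)
    qed
    then have "of_nat 1 < \<bar>\<delta>\<bar>" unfolding infinite_hyp_def by blast
    then have "\<not> infinitesimal (hangle p q x)" "\<not> infinitesimal (hangle x p q)"
      unfolding pqx using that(2) nz assms(9)
      by (auto simp: not_infinitesimal_angle_p not_infinitesimal_angle_x)
    then show ?thesis by (simp add: num_infinitesimal_angles_def)
  qed

  have "\<exists>H\<in>\<Q>. conjugate_SL3 ?G H"
    using C F A3 N12 N3 unfolding \<Q>_def finite_hyp_def by (smt (verit) insertI1 insertI2)
  moreover have "conjugate_SL3 ?G group_C"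
    if "num_infinitesimal_sides p q x = 0" "appreciable \<alpha>"
  proof -
    have \<delta>: "\<not> infinitesimal \<delta>" using that(1) by (rule sides)
    then have r: "finite_hyp (\<epsilon> / \<eta>)" using A3 that(2) by (auto simp: appreciable_def)
    \<comment> \<open>Otherwise \<epsilon> would be infinitesimal too, and with it the side
      \<open>xp\<close>.\<close>
    have "\<not> infinitesimal \<eta>"
      using that(1) xp \<epsilon>\<eta> r by (auto simp: num_infinitesimal_sides_def split: if_splits)
    with \<delta> r show ?thesis by (intro C)
  qed
  moreover have "conjugate_SL3 ?G group_F"
    if "num_infinitesimal_sides p q x = 1" "finite_hyp \<alpha>"
  proof -
    have \<delta>: "\<not> infinitesimal \<delta>" using that(1) by (rule sides)
    then have r: "finite_hyp (\<epsilon> / \<eta>)" using A3 that(2) by (auto simp: finite_hyp_def)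
    \<comment> \<open>Otherwise \<open>x\<close> would be far from the line \<open>pq\<close>, and
      no side would be infinitesimal.\<close>
    have "infinitesimal \<eta>"
      using that(1) far r \<delta> pq by (auto simp: num_infinitesimal_sides_def split: if_splits)
    with \<delta> r show ?thesis by (intro F)
  qed
  moreover have "conjugate_SL3 ?G group_N1"
    if "num_infinitesimal_sides p q x = 3" "appreciable \<alpha>"
    using N12 sides(1) that by (auto simp: appreciable_def finite_hyp_def)
  moreover have "conjugate_SL3 ?G group_N2"
    if "num_infinitesimal_sides p q x = 3" "infinitesimal \<alpha>"
    using N12 sides(1) that by (auto simp: infinitesimal_imp_finite)
  \<comment> \<open>For noninfinitesimal \<delta> the angle count excludes a finite
    \<open>\<epsilon> / \<eta>\<close>, which leaves the case \<open>A3\<close>.\<close>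
  moreover have "conjugate_SL3 ?G group_N3"
    if "num_infinitesimal_angles p q x = 2" "infinite_hyp \<alpha>"
    using N3 A3 angles that by blast
  ultimately show ?thesis unfolding G by blast
qed

end
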